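(* Let $\phi=(\phi_i)_{i\ge1}:\overline{\mathbb{D}}^\infty\to\overline{\mathbb{D}}^\infty$ be a map such that $C_\phi f=f\circ\phi$ maps $A^+(\mathbb{T}^\infty)$ into itself, and such that moreover $\phi(\mathbb{T}^\infty)\subseteq\mathbb{T}^\infty$. Then: (a) There exist a matrix $A=(a_{ij})_{i,j\ge1}$ with $a_{ij}\in\mathbb{N}_0$ and $\sum_ja_{ij}<\infty$ for each $i$, and complex numbers $\epsilon_i$ of modulus $1$, such that $\phi_i(z)=\epsilon_i\prod_{j\ge1}z_j^{a_{ij}}$ for $i=1,2,\dots$. (b) $C_\phi$ is an isometry of $A^+(\mathbb{T}^\infty)$ if and only if the map $A^*:\mathbb{Z}^{(\infty)}\to\mathbb{Z}^{(\infty)}$, $A^*(\alpha)=\gamma$ with $\gamma_j=\sum_{i\ge1}a_{ij}\alpha_i$, is injective.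
   Context: $A^+(\mathbb{T}^\infty)$ is the algebra of functions $f(z)=\sum_\alpha a_\alpha z^\alpha$ on $\overline{\mathbb{D}}^\infty$, $\alpha$ ranging over $\mathbb{N}_0^{(\infty)}$ (finitely supported sequences of non-negative integers), $z^\alpha=\prod_jz_j^{\alpha_j}$, with $\|f\|=\sum|a_\alpha|<\infty$; a Banach algebra under pointwise multiplication. $\mathbb{T}^\infty$ is the set of sequences of complex numbers of modulus $1$. $\mathbb{Z}^{(\infty)}$ is the set of finitely supported integer sequences. *)

theory Defs
  imports "HOL-Analysis.Analysis"
begin

text \<open>Points of the infinite polydisc / torus are sequences indexed by nat
  (index 0 plays the role of index 1 in the paper).\<close>

definition polydisc :: "(nat \<Rightarrow> complex) set" where
  "polydisc = {z. \<forall>j. norm (z j) \<le> 1}"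

definition torus :: "(nat \<Rightarrow> complex) set" where
  "torus = {z. \<forall>j. norm (z j) = 1}"

definition multi_idx :: "(nat \<Rightarrow> nat) set" where
  "multi_idx = {\<alpha>. finite {j. \<alpha> j \<noteq> 0}}"

definition int_fin :: "(nat \<Rightarrow> int) set" where
  "int_fin = {\<alpha>. finite {j. \<alpha> j \<noteq> 0}}"

definition monom :: "(nat \<Rightarrow> nat) \<Rightarrow> (nat \<Rightarrow> complex) \<Rightarrow> complex" where
  "monom \<alpha> z = (\<Prod>j\<in>{j. \<alpha> j \<noteq> 0}. z j ^ \<alpha> j)"

definition represents :: "((nat \<Rightarrow> nat) \<Rightarrow> complex) \<Rightarrow> ((nat \<Rightarrow> complex) \<Rightarrow> complex) \<Rightarrow> bool" where
  "represents c f \<longleftrightarrow> (\<lambda>\<alpha>. norm (c \<alpha>)) summable_on multi_idx \<and>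
     (\<forall>z\<in>polydisc. f z = (\<Sum>\<^sub>\<infinity>\<alpha>\<in>multi_idx. c \<alpha> * monom \<alpha> z))"

definition A_plus :: "((nat \<Rightarrow> complex) \<Rightarrow> complex) set" where
  "A_plus = {f. \<exists>c. represents c f}"

text \<open>Its norm \<open>\<Sum>|a_\<alpha>|\<close> (coefficients are uniquely determined by f on the polydisc).\<close>
definition A_norm :: "((nat \<Rightarrow> complex) \<Rightarrow> complex) \<Rightarrow> real" where
  "A_norm f = (\<Sum>\<^sub>\<infinity>\<alpha>\<in>multi_idx. norm ((SOME c. represents c f) \<alpha>))"

definition A_star :: "(nat \<Rightarrow> nat \<Rightarrow> nat) \<Rightarrow> (nat \<Rightarrow> int) \<Rightarrow> (nat \<Rightarrow> int)" where
  "A_star a \<alpha> = (\<lambda>j. \<Sum>i\<in>{i. \<alpha> i \<noteq> 0}. int (a i j) * \<alpha> i)"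

end

theory Submission
  imports "HOL-Complex_Analysis.Conformal_Mappings" Defs
begin

text \<open>
  Fix a point \<open>z\<close> of the torus and an index \<open>j\<close>, and let \<open>G x\<close> be the \<open>i\<close>-th component of \<open>\<phi>\<close> at the
  point obtained from \<open>z\<close> by replacing \<open>z j\<close> with \<open>x * z j\<close>. It has an absolutely convergent power
  series and modulus 1 on the unit circle, so it is a finite Blaschke product, in particular a
  quotient of polynomials on the circle. A gliding hump argument shows that the coefficient norms
  of the powers \<open>G ^ n\<close> are bounded by some \<open>C\<close>.

  Sample \<open>G\<close> at the \<open>M\<close>-th roots of unity, \<open>v x = G (\<omega> ^ x)\<close>. The discrete Fourier coefficients of
  \<open>v ^ n\<close> have l2-norm 1 and l1-norm at most \<open>C\<close>, so their fourth powers sum to at least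
  \<open>1 / (8 C^2)\<close>. This sum equals \<open>M^-3\<close> times the sum of \<open>(v x v x' / (v y v y')) ^ n\<close> over the
  solutions of \<open>x + x' = y + y'\<close> modulo \<open>M\<close>, so averaging over \<open>n\<close> shows that \<open>v x v x' = v y v y'\<close> for at
  least \<open>M^3 / (8 C^2)\<close> of these. Since \<open>G\<close> is rational, there are only \<open>O(M^2)\<close> of them unless
  \<open>G\<close> is a monomial. Hence \<open>G\<close> is a monomial whose degree, by connectedness of the torus, does not
  depend on \<open>z\<close>; as this holds for every \<open>j\<close>, only one Taylor coefficient of the component is nonzero.

  For the isometry criterion, composition with \<open>\<phi>\<close> moves the coefficient at \<open>\<alpha>\<close>, up to a unimodular
  factor, to the exponent \<open>A* \<alpha>\<close>. If \<open>A*\<close> is injective nothing is merged; otherwise the positive and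
  negative parts of a kernel element give two monomials with the same image up to a constant.
\<close>

no_notation Infinite_Set_Sum.abs_summable_on (infix "abs'_summable'_on" 50)

section \<open>Unimodular functions in the disc algebra are rational on the circle\<close>

lemma eq_const_on_cball_if_on_ball:
  fixes G :: "complex \<Rightarrow> complex"
  assumes "continuous_on (cball 0 1) G" and "\<And>x. x \<in> ball 0 1 \<Longrightarrow> G x = c" and "x \<in> cball 0 1"
  shows "G x = c"
proof -
  have cl: "closure (ball 0 1) = cball (0::complex) 1" by simp
  show ?thesis
    by (rule continuous_constant_on_closure[of "ball 0 1" G c x]) (use assms cl in auto)
qed

text \<open>This is what makes the Blaschke factor (x - a) / (1 - cnj a * x) unimodular on the
  circle; it comes from 1 = x * cnj x.\<close>

lemma norm_one_minus_cnj_mult: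
  assumes "norm (x::complex) = 1"
  shows "norm (1 - cnj a * x) = norm (x - a)"
proof -
  have "x * cnj x = 1" using assms by (simp add: complex_norm_square[symmetric])
  hence "1 - cnj a * x = x * cnj (x - a)" by (simp add: algebra_simps)
  thus ?thesis using assms by (simp add: norm_mult del: complex_cnj_diff)
qed

text \<open>Induction on the number of distinct zeros in the closed disc: a zero is removed together
  with its multiplicity by dividing out a power of a Blaschke factor, which preserves all
  hypotheses. Without zeros, the maximum principle for both \<open>G\<close> and its inverse forces
  \<open>G\<close> to be constant.\<close>

lemma circle_unimodular_imp_rational:
  fixes G :: "complex \<Rightarrow> complex"
  assumes "continuous_on (cball 0 1) G" "G holomorphic_on ball 0 1"
    and "\<And>x. norm x = 1 \<Longrightarrow> norm (G x) = 1"
  shows "\<exists>P Q :: complex poly. \<forall>x. norm x = 1 \<longrightarrow> poly Q x \<noteq> 0 \<and> G x = poly P x / poly Q x"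
  using assms
proof (induction "card {x \<in> cball 0 1. G x = 0}" arbitrary: G rule: less_induct)
  case less
  note cont = less.prems(1) and hol = less.prems(2) and uni = less.prems(3)
  define S where "S = {x \<in> cball 0 1. G x = 0}"
  have S_ball: "S \<subseteq> ball 0 1"
  proof
    fix x assume "x \<in> S"
    thus "x \<in> ball 0 1" using uni[of x] by (cases "norm x = 1") (auto simp: S_def)
  qed
  have no_const0: "\<exists>x\<in>ball 0 1. G x \<noteq> 0"
  proof (rule ccontr)
    assume neg: "\<not> ?thesis"
    have "G 1 = 0" by (rule eq_const_on_cball_if_on_ball[OF cont]) (use neg in auto)
    thus False using uni[of 1] by simp
  qed
  have closed_S: "closed S"
    unfolding S_def using continuous_closed_preimage_constant[OF cont closed_cball, of 0] by simp
  \<comment> \<open>Infinitely many zeros would accumulate at a zero. As no zero lies on the circle,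
    the accumulation point is in the open disc, and the identity theorem makes \<open>G\<close>
    vanish there.\<close>
  have fin: "finite S"
  proof (rule ccontr)
    assume "infinite S"
    moreover have "S \<subseteq> cball 0 1" by (auto simp: S_def)
    ultimately obtain x where x: "x islimpt S"
      using compact_cball[of "0::complex" 1] by (meson compact_eq_Bolzano_Weierstrass)
    have "x \<in> S" using closed_S x closed_limpt by blast
    hence "x \<in> ball 0 1" using S_ball by blast
    hence "G w = 0" if "w \<in> ball 0 1" for w
      using analytic_continuation[OF hol open_ball connected_ball S_ball _ x _ that] S_def by blast
    thus False using no_const0 by blast
  qed
  show ?case
  proof (cases "S = {}")
    case True
    hence nz: "G x \<noteq> 0" if "x \<in> cball 0 1" for x using that by (auto simp: S_def)
    have le: "norm (G x) \<le> 1" if "x \<in> cball 0 1" for x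
      by (rule maximum_modulus_frontier[of G "cball 0 1"]) (use cont hol uni that in \<open>auto simp: frontier_def\<close>)
    have ge: "norm (inverse (G x)) \<le> 1" if "x \<in> cball 0 1" for x
      by (rule maximum_modulus_frontier[of "\<lambda>x. inverse (G x)" "cball 0 1"])
         (use cont hol uni that nz in \<open>auto simp: frontier_def norm_inverse intro!: holomorphic_intros continuous_intros\<close>)
    have one: "norm (G x) = 1" if "x \<in> cball 0 1" for x
      using le[OF that] ge[OF that] nz[OF that] one_le_inverse_iff[of "norm (G x)"]
      by (simp add: norm_inverse inverse_le_1_iff)
    have "G constant_on ball 0 1"
      by (rule maximum_modulus_principle[OF hol open_ball connected_ball open_ball order_refl, of 0])
         (use one in auto)
    then obtain c where c: "\<And>x. x \<in> ball 0 1 \<Longrightarrow> G x = c" by (auto simp: constant_on_def)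
    have "G x = c" if "norm x = 1" for x
      by (rule eq_const_on_cball_if_on_ball[OF cont c]) (use that in auto)
    thus ?thesis by (intro exI[of _ "[:c:]"] exI[of _ 1]) auto
  next
    case False
    then obtain a where a: "a \<in> S" by blast
    have a1: "norm a < 1" and Ga: "G a = 0" using a S_ball by (auto simp: S_def)
    have aball: "a \<in> ball 0 1" using a1 by simp
    have nc: "\<not> G constant_on ball 0 1"
    proof
      assume "G constant_on ball 0 1"
      then obtain c where c: "\<And>x. x \<in> ball 0 1 \<Longrightarrow> G x = c" by (auto simp: constant_on_def)
      thus False using c[of a] a1 Ga no_const0 by auto
    qed
    obtain g r n where n: "0 < n" and r: "0 < r" "ball a r \<subseteq> ball 0 1"
      and g: "g holomorphic_on ball a r" "\<And>w. w \<in> ball a r \<Longrightarrow> G w = (w - a) ^ n * g w"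
        "\<And>w. w \<in> ball a r \<Longrightarrow> g w \<noteq> 0"
      by (rule holomorphic_factor_zero_nonconstant[OF hol open_ball connected_ball aball Ga nc]) blast
    \<comment> \<open>\<open>h\<close> is the quotient by (w - a)^n with its removable singularity
      filled in; the factor (1 - cnj a * w)^n in \<open>G'\<close> restores modulus 1 on the
      circle.\<close>
    define h where "h w = (if w = a then g a else G w / (w - a) ^ n)" for w
    define G' where "G' w = h w * (1 - cnj a * w) ^ n" for w
    have h1: "h holomorphic_on ball a r"
      by (rule holomorphic_transform[OF g(1)]) (auto simp: h_def g(2))
    have h2: "h holomorphic_on (ball 0 1 - {a})"
      by (rule holomorphic_transform[of "\<lambda>w. G w / (w - a) ^ n"])
         (auto simp: h_def intro!: holomorphic_intros holomorphic_on_subset[OF hol])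
    have "h holomorphic_on (ball a r \<union> (ball 0 1 - {a}))"
      by (rule holomorphic_on_Un[OF h1 h2]) auto
    moreover have "ball a r \<union> (ball 0 1 - {a}) = ball 0 1" using r by auto
    ultimately have holh: "h holomorphic_on ball 0 1" by simp
    \<comment> \<open>Continuity of \<open>h\<close> up to the boundary is glued from two closed
      pieces: a smaller disc containing \<open>a\<close>, where \<open>h\<close> is holomorphic, and
      the remaining annulus, where \<open>h\<close> is the plain quotient.\<close>
    obtain \<rho> where \<rho>: "norm a < \<rho>" "\<rho> < 1" using a1 dense by blast
    have "continuous_on (cball 0 \<rho> \<union> (cball 0 1 - ball 0 \<rho>)) h"
    proof (rule continuous_on_closed_Un)
      show "continuous_on (cball 0 \<rho>) h"
        using holomorphic_on_imp_continuous_on[OF holh] by (rule continuous_on_subset) (use \<rho> in auto)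
      show "continuous_on (cball 0 1 - ball 0 \<rho>) h"
        by (rule continuous_on_eq[of _ "\<lambda>w. G w / (w - a) ^ n"])
           (use \<rho> in \<open>auto simp: h_def intro!: continuous_intros continuous_on_subset[OF cont]\<close>)
    qed auto
    moreover have "cball 0 \<rho> \<union> (cball 0 1 - ball 0 \<rho>) = cball (0::complex) 1" using \<rho> by auto
    ultimately have conth: "continuous_on (cball 0 1) h" by simp
    have contG': "continuous_on (cball 0 1) G'"
      unfolding G'_def by (intro continuous_intros conth)
    have holG': "G' holomorphic_on ball 0 1"
      unfolding G'_def by (intro holomorphic_intros holh)
    have nea: "x \<noteq> a" if "norm x = 1" for x using a1 that by auto
    have uniG': "norm (G' x) = 1" if "norm x = 1" for x
      using nea[OF that] that uni[OF that] norm_one_minus_cnj_mult[OF that, of a]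
      by (simp add: G'_def h_def norm_mult norm_divide norm_power)
    have cnz: "1 - cnj a * x \<noteq> 0" if "norm x \<le> 1" for x
    proof
      assume "1 - cnj a * x = 0"
      hence "norm (cnj a * x) = 1" by simp
      moreover have "norm (cnj a * x) < 1"
        using a1 mult_left_mono[OF that norm_ge_zero[of a]] by (simp add: norm_mult)
      ultimately show False by simp
    qed
    \<comment> \<open>The zero \<open>a\<close> disappears, and since 1 - cnj a * x has no zeros in
      the closed disc, no new one appears.\<close>
    have "{x \<in> cball 0 1. G' x = 0} \<subset> S"
    proof -
      have "a \<notin> {x \<in> cball 0 1. G' x = 0}"
        using g(3)[of a] r cnz[of a] a1 by (auto simp: G'_def h_def)
      moreover have "{x \<in> cball 0 1. G' x = 0} \<subseteq> S"
        using a cnz by (auto simp: G'_def h_def S_def split: if_splits)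
      ultimately show ?thesis using a by blast
    qed
    hence "card {x \<in> cball 0 1. G' x = 0} < card {x \<in> cball 0 1. G x = 0}"
      using fin psubset_card_mono unfolding S_def by blast
    from less.hyps[OF this contG' holG' uniG'] obtain P Q :: "complex poly"
      where PQ: "\<And>x. norm x = 1 \<Longrightarrow> poly Q x \<noteq> 0 \<and> G' x = poly P x / poly Q x" by blast
    have "poly (Q * [:1, - cnj a:] ^ n) x \<noteq> 0 \<and>
          G x = poly (P * [:- a, 1:] ^ n) x / poly (Q * [:1, - cnj a:] ^ n) x" if "norm x = 1" for x
    proof -
      have "G x = G' x * (x - a) ^ n / (1 - cnj a * x) ^ n"
        using nea[OF that] cnz[of x] that by (simp add: G'_def h_def)
      thus ?thesis using PQ[OF that] cnz[of x] that by (simp add: algebra_simps)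
    qed
    thus ?thesis by blast
  qed
qed

section \<open>Additive quadruples in the cyclic group\<close>

text \<open>This is \<omega>^k for the primitive \<open>M\<close>-th root \<omega>; the exponent is
  an integer so that differences of indices are available.\<close>

definition unity_root :: "nat \<Rightarrow> int \<Rightarrow> complex" where
  "unity_root M k = cis (2 * pi * of_int k / of_nat M)"

lemma norm_unity_root [simp]: "norm (unity_root M k) = 1"
  by (simp add: unity_root_def)

lemma unity_root_nz [simp]: "unity_root M k \<noteq> 0"
  using norm_unity_root[of M k] by force

lemma unity_root_add: "unity_root M (j + k) = unity_root M j * unity_root M k"
  by (simp add: unity_root_def cis_mult[symmetric] ring_distribs add_divide_distrib)

lemma unity_root_minus: "unity_root M (- k) = cnj (unity_root M k)"
  by (simp add: unity_root_def cis_cnj)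

lemma unity_root_diff: "unity_root M (j - k) = unity_root M j * cnj (unity_root M k)"
  using unity_root_add[of M j "-k"] by (simp add: unity_root_minus)

lemma unity_root_power: "unity_root M k ^ n = unity_root M (k * int n)"
  unfolding unity_root_def by (subst Complex.DeMoivre, rule arg_cong[of _ _ cis]) (simp add: mult_ac)

lemma unity_root_eq_1_iff:
  assumes "M > 0"
  shows "unity_root M k = 1 \<longleftrightarrow> int M dvd k"
proof
  assume "unity_root M k = 1"
  hence "cos (2 * pi * of_int k / of_nat M) = 1"
    by (simp add: unity_root_def complex_eq_iff)
  then obtain n :: int where "2 * pi * of_int k / of_nat M = of_int n * 2 * pi"
    using cos_one_2pi_int by blast
  hence "2 * pi * of_int k = 2 * pi * (of_int n * of_nat M)" using assms by (simp add: field_simps)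
  hence "(of_int k :: real) = of_int n * of_nat M" by simp
  hence "real_of_int k = real_of_int (n * int M)" by simp
  hence "k = n * int M" by (simp only: of_int_eq_iff)
  thus "int M dvd k" by simp
next
  assume "int M dvd k"
  then obtain n where "k = int M * n" by blast
  hence "2 * pi * of_int k / of_nat M = 2 * pi * of_int n" using assms by simp
  thus "unity_root M k = 1" using cis_multiple_2pi[of "of_int n"] by (simp only: unity_root_def Ints_of_int)
qed

lemma unity_root_eq_iff:
  assumes "M > 0"
  shows "unity_root M j = unity_root M k \<longleftrightarrow> int M dvd (j - k)"
proof -
  have "unity_root M j = unity_root M (j - k) * unity_root M k"
    using unity_root_add[of M "j - k" k] by simp
  thus ?thesis using unity_root_eq_1_iff[OF assms, of "j - k"] by auto
qed

lemma inj_on_unity_root: "inj_on (\<lambda>j. unity_root M (int j + c)) {..<M}"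
proof (rule inj_onI)
  fix x y assume xy: "x \<in> {..<M}" "y \<in> {..<M}" "unity_root M (int x + c) = unity_root M (int y + c)"
  hence "int M dvd (int x - int y)" using unity_root_eq_iff[of M "int x + c" "int y + c"] by auto
  hence "int x mod int M = int y mod int M" by (simp add: mod_eq_dvd_iff)
  thus "x = y" using xy by simp
qed

lemma sum_unity_root:
  assumes "M > 0"
  shows "(\<Sum>j<M. unity_root M (k * int j)) = (if int M dvd k then of_nat M else 0)"
proof (cases "int M dvd k")
  case True
  hence "unity_root M (k * int j) = 1" for j
    using unity_root_eq_1_iff[OF assms] by simp
  thus ?thesis using True by simp
next
  case False
  have "unity_root M k ^ M = 1"
    using unity_root_eq_1_iff[OF assms] by (simp add: unity_root_power)
  moreover have "unity_root M k \<noteq> 1" using False unity_root_eq_1_iff[OF assms] by simp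
  ultimately have "(\<Sum>j<M. unity_root M k ^ j) = 0" by (simp add: geometric_sum)
  thus ?thesis using False by (simp add: unity_root_power)
qed

text \<open>Expand the square as a double sum; by orthogonality of characters, summing over
  \<open>r\<close> keeps exactly the pairs with congruent frequencies. It serves twice: with single
  indices it gives Parseval, with pairs of indices the fourth moment.\<close>

lemma sum_norm_square_trig:
  assumes "M > 0" "finite I"
  shows "(\<Sum>r<M. of_real ((norm (\<Sum>i\<in>I. u i * unity_root M (- (h i * int r))))\<^sup>2)) =
         of_nat M * (\<Sum>(i, k) \<in> {(i, k) \<in> I \<times> I. int M dvd (h i - h k)}. u i * cnj (u k))"
proof -
  have "(\<Sum>r<M. of_real ((norm (\<Sum>i\<in>I. u i * unity_root M (- (h i * int r))))\<^sup>2)) =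
        (\<Sum>r<M. \<Sum>(i, k) \<in> I \<times> I. u i * cnj (u k) * unity_root M ((h k - h i) * int r))"
  proof (intro sum.cong refl)
    fix r
    let ?S = "\<Sum>i\<in>I. u i * unity_root M (- (h i * int r))"
    have "of_real ((norm ?S)\<^sup>2) = ?S * cnj ?S" by (rule complex_norm_square)
    also have "\<dots> = (\<Sum>(i, k) \<in> I \<times> I. (u i * unity_root M (- (h i * int r))) * cnj (u k * unity_root M (- (h k * int r))))"
      by (simp only: cnj_sum sum_product sum.cartesian_product)
    also have "\<dots> = (\<Sum>(i, k) \<in> I \<times> I. u i * cnj (u k) * unity_root M ((h k - h i) * int r))"
      by (intro sum.cong refl) (auto simp: left_diff_distrib unity_root_diff unity_root_minus)
    finally show "of_real ((norm ?S)\<^sup>2) = (\<Sum>(i, k) \<in> I \<times> I. u i * cnj (u k) * unity_root M ((h k - h i) * int r))" .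
  qed
  also have "\<dots> = (\<Sum>(i, k) \<in> I \<times> I. u i * cnj (u k) * (\<Sum>r<M. unity_root M ((h k - h i) * int r)))"
    by (subst sum.swap) (simp add: sum_distrib_left case_prod_unfold)
  also have "\<dots> = (\<Sum>(i, k) \<in> I \<times> I. if int M dvd (h i - h k) then of_nat M * (u i * cnj (u k)) else 0)"
    by (intro sum.cong refl) (auto simp: sum_unity_root[OF assms(1)] dvd_diff_commute)
  also have "\<dots> = (\<Sum>(i, k) \<in> {(i, k) \<in> I \<times> I. int M dvd (h i - h k)}. of_nat M * (u i * cnj (u k)))"
    by (rule sum.mono_neutral_cong_right) (use assms(2) in \<open>auto split: if_splits\<close>)
  finally show ?thesis by (simp add: sum_distrib_left case_prod_unfold)
qed

text \<open>The normalisation by 1/M makes the squared coefficients of a unimodular sequence sum to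
  1.\<close>

definition dft :: "nat \<Rightarrow> (nat \<Rightarrow> complex) \<Rightarrow> nat \<Rightarrow> complex" where
  "dft M v r = (\<Sum>j<M. v j * unity_root M (- (int j * int r))) / of_nat M"

lemma sum_norm_dft_square:
  assumes "M > 0" "\<And>j. norm (v j) = 1"
  shows "(\<Sum>r<M. (norm (dft M v r))\<^sup>2) = 1"
proof -
  \<comment> \<open>Indices below \<open>M\<close> that are congruent modulo \<open>M\<close> are
    equal, so only the diagonal survives.\<close>
  have eq: "{(i, k) \<in> {..<M} \<times> {..<M}. int M dvd (int i - int k)} = (\<lambda>i. (i, i)) ` {..<M}"
    by (auto simp: mod_eq_dvd_iff[symmetric])
  have nd: "(norm (dft M v r))\<^sup>2 = (norm (\<Sum>j<M. v j * unity_root M (- (int j * int r))))\<^sup>2 / (real M)\<^sup>2" for r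
    by (simp add: dft_def norm_divide power_divide)
  have "complex_of_real (\<Sum>r<M. (norm (dft M v r))\<^sup>2) =
     (\<Sum>r<M. of_real ((norm (\<Sum>j<M. v j * unity_root M (- (int j * int r))))\<^sup>2)) / (of_nat M)\<^sup>2"
    by (simp add: nd sum_divide_distrib)
  also have "\<dots> = of_nat M * (\<Sum>i<M. v i * cnj (v i)) / (of_nat M)\<^sup>2"
    by (subst sum_norm_square_trig[OF assms(1)], simp, subst eq, subst sum.reindex) (auto simp: inj_on_def)
  also have "\<dots> = (1 :: complex)"
    using assms by (simp add: complex_norm_square[symmetric] power2_eq_square)
  finally show ?thesis using of_real_eq_1_iff by blast
qed

definition additive_quadruples :: "nat \<Rightarrow> ((nat \<times> nat) \<times> (nat \<times> nat)) set" where
  "additive_quadruples M = {((x, x'), (y, y')) \<in> ({..<M} \<times> {..<M}) \<times> ({..<M} \<times> {..<M}).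
     int M dvd ((int x + int x') - (int y + int y'))}"

lemma finite_additive_quadruples [simp]: "finite (additive_quadruples M)"
  by (rule finite_subset[of _ "({..<M} \<times> {..<M}) \<times> ({..<M} \<times> {..<M})"])
     (auto simp: additive_quadruples_def)

text \<open>The square of a coefficient is again a trigonometric sum, indexed by pairs with
  frequency x + x', so its second moment is the fourth moment wanted. The normalisation contributes
  M^-4 and orthogonality a factor M.\<close>

lemma sum_norm_dft_power4:
  assumes "M > 0"
  shows "of_real (\<Sum>r<M. (norm (dft M v r)) ^ 4) =
     (\<Sum>((x, x'), (y, y')) \<in> additive_quadruples M. v x * v x' * cnj (v y * v y')) / of_nat M ^ 3"
proof -
  let ?u = "\<lambda>(x, x'). v x * v x'" and ?h = "\<lambda>(x, x'). int x + int x'"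
  have sq: "(dft M v r)\<^sup>2 = (\<Sum>p\<in>{..<M} \<times> {..<M}. ?u p * unity_root M (- (?h p * int r))) / (of_nat M)\<^sup>2" for r
  proof -
    have ur: "unity_root M (- ((int x + int x') * int r)) =
        unity_root M (- (int x * int r)) * unity_root M (- (int x' * int r))" for x x'
      by (simp add: unity_root_add[symmetric] ring_distribs)
    show ?thesis
      by (simp add: dft_def power_divide power2_eq_square sum_product sum.cartesian_product
          case_prod_unfold ur mult.assoc mult.left_commute)
  qed
  have nd: "(norm (dft M v r)) ^ 4 = (norm (\<Sum>p\<in>{..<M} \<times> {..<M}. ?u p * unity_root M (- (?h p * int r))))\<^sup>2 / (real M) ^ 4" for r
  proof -
    have "(norm (dft M v r)) ^ 4 = (norm ((dft M v r)\<^sup>2))\<^sup>2" by (simp add: norm_power)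
    thus ?thesis unfolding sq by (simp add: norm_divide power_divide norm_power)
  qed
  have "complex_of_real (\<Sum>r<M. (norm (dft M v r)) ^ 4) =
    (\<Sum>r<M. of_real ((norm (\<Sum>p\<in>{..<M} \<times> {..<M}. ?u p * unity_root M (- (?h p * int r))))\<^sup>2)) / (of_nat M) ^ 4"
    by (simp add: nd sum_divide_distrib)
  also have "\<dots> = of_nat M * (\<Sum>(p, q) \<in> {(p, q) \<in> ({..<M} \<times> {..<M}) \<times> ({..<M} \<times> {..<M}). int M dvd (?h p - ?h q)}. ?u p * cnj (?u q)) / of_nat M ^ 4"
    by (subst sum_norm_square_trig[OF assms]) auto
  also have "{(p, q) \<in> ({..<M} \<times> {..<M}) \<times> ({..<M} \<times> {..<M}). int M dvd (?h p - ?h q)} = additive_quadruples M"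
    by (auto simp: additive_quadruples_def)
  also have "of_nat M * (\<Sum>(p, q) \<in> additive_quadruples M. ?u p * cnj (?u q)) / of_nat M ^ 4 =
     (\<Sum>(p, q) \<in> additive_quadruples M. ?u p * cnj (?u q)) / of_nat M ^ 3"
    using assms by (simp add: power4_eq_xxxx power3_eq_cube)
  finally show ?thesis by (simp add: case_prod_unfold)
qed

section \<open>Averaging over the powers of a unimodular sequence\<close>

lemma cesaro_unimodular_powers:
  assumes "norm (z :: complex) = 1"
  shows "(\<lambda>N. (\<Sum>n<N. z ^ n) / of_nat N) \<longlonglongrightarrow> (if z = 1 then 1 else 0)"
proof (cases "z = 1")
  case True
  have "(\<lambda>N. 1) \<longlonglongrightarrow> (1::complex)" by simp
  moreover have "eventually (\<lambda>N. 1 = (\<Sum>n<N. z ^ n) / of_nat N) sequentially"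
    using eventually_gt_at_top[of 0] by eventually_elim (simp add: True)
  ultimately have "(\<lambda>N. (\<Sum>n<N. z ^ n) / of_nat N) \<longlonglongrightarrow> 1"
    by (rule Lim_transform_eventually)
  thus ?thesis by (simp only: True refl if_True)
next
  case False
  have lim: "(\<lambda>N. (2 / norm (z - 1)) / of_nat N) \<longlonglongrightarrow> 0"
    by (rule lim_const_over_n)
  \<comment> \<open>The geometric sum is at most 2 / |z - 1| for every N.\<close>
  have le: "norm ((\<Sum>n<N. z ^ n) / of_nat N) \<le> (2 / norm (z - 1)) / of_nat N" for N
  proof -
    have "norm (z ^ N - 1) \<le> 2"
      using norm_triangle_ineq4[of "z ^ N" 1] assms by (simp add: norm_power)
    thus ?thesis using False by (simp add: geometric_sum norm_divide norm_mult divide_right_mono)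
  qed
  have "(\<lambda>N. (\<Sum>n<N. z ^ n) / of_nat N) \<longlonglongrightarrow> 0"
    by (rule Lim_null_comparison[OF always_eventually lim]) (use le in blast)
  thus ?thesis using False by simp
qed

text \<open>Entries up to 1/(2C) contribute at most 1/(2C) * C = 1/2 to the sum of squares. The
  larger ones must supply the other half, and they satisfy s^2 \<le> 4 C^2 s^4. The pointwise
  inequality \<open>pt\<close> treats both cases at once.\<close>

lemma sum_power4_lower_bound:
  assumes "finite I" "\<And>i. i \<in> I \<Longrightarrow> t i \<ge> (0::real)" "(\<Sum>i\<in>I. (t i)\<^sup>2) = 1" "(\<Sum>i\<in>I. t i) \<le> C" "C > 0"
  shows "(\<Sum>i\<in>I. t i ^ 4) \<ge> 1 / (8 * C\<^sup>2)"
proof -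
  have pt: "s\<^sup>2 \<le> s / (2 * C) + 4 * C\<^sup>2 * s ^ 4" if "s \<ge> 0" for s
  proof (cases "s \<le> 1 / (2 * C)")
    case True
    have "s\<^sup>2 \<le> s / (2 * C)"
      using mult_left_mono[OF True that] by (simp add: power2_eq_square)
    moreover have "0 \<le> 4 * C\<^sup>2 * s ^ 4" by simp
    ultimately show ?thesis by linarith
  next
    case False
    hence "1 \<le> 2 * C * s" using assms(5) by (simp add: field_simps)
    hence "1 \<le> (2 * C * s)\<^sup>2" by (simp add: one_le_power)
    hence "s\<^sup>2 * 1 \<le> s\<^sup>2 * (2 * C * s)\<^sup>2" by (intro mult_left_mono) auto
    also have "\<dots> = 4 * C\<^sup>2 * s ^ 4" by (simp add: power_mult_distrib power2_eq_square power4_eq_xxxx)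
    finally have "s\<^sup>2 \<le> 4 * C\<^sup>2 * s ^ 4" by simp
    moreover have "0 \<le> s / (2 * C)" using that assms(5) by simp
    ultimately show ?thesis by linarith
  qed
  have "1 \<le> (\<Sum>i\<in>I. t i / (2 * C) + 4 * C\<^sup>2 * t i ^ 4)"
    unfolding assms(3)[symmetric] by (intro sum_mono pt assms(2))
  also have "\<dots> = (\<Sum>i\<in>I. t i) / (2 * C) + 4 * C\<^sup>2 * (\<Sum>i\<in>I. t i ^ 4)"
    by (simp add: sum.distrib sum_divide_distrib sum_distrib_left)
  also have "(\<Sum>i\<in>I. t i) / (2 * C) \<le> C / (2 * C)"
    using assms(4,5) by (intro divide_right_mono) auto
  also have "C / (2 * C) = 1 / 2" using assms(5) by simp
  finally have "1 / 2 \<le> 4 * C\<^sup>2 * (\<Sum>i\<in>I. t i ^ 4)" by simp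
  thus ?thesis using assms(5) by (simp add: field_simps)
qed

text \<open>The fourth moment of the \<open>n\<close>-th power is a sum of
  \<open>\<zeta> q ^ n\<close> over the additive quadruples, bounded below uniformly in
  \<open>n\<close>. Averaging over \<open>n\<close> leaves 1 for each \<open>q\<close> with
  \<open>\<zeta> q = 1\<close> and 0 otherwise, so the lower bound becomes a count.\<close>

lemma card_multiplicative_quadruples_ge:
  assumes M: "M > 0" and v: "\<And>j. norm (v j) = 1" and C: "C > 0"
    and bd: "\<And>n. (\<Sum>r<M. norm (dft M (\<lambda>j. v j ^ n) r)) \<le> C"
  shows "real (card {((x, x'), (y, y')) \<in> additive_quadruples M. v x * v x' = v y * v y'}) \<ge> real M ^ 3 / (8 * C\<^sup>2)"
proof -
  let ?Q = "additive_quadruples M"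
  define \<zeta> where "\<zeta> = (\<lambda>((x, x'), (y, y')). v x * v x' * cnj (v y * v y'))"
  have n\<zeta>: "norm (\<zeta> q) = 1" for q
    using v by (auto simp: \<zeta>_def norm_mult split: prod.splits)
  have lower: "Re (\<Sum>q\<in>?Q. \<zeta> q ^ n) \<ge> real M ^ 3 / (8 * C\<^sup>2)" for n
  proof -
    have n1: "norm (v j ^ n) = 1" for j using v by (simp add: norm_power)
    have "1 / (8 * C\<^sup>2) \<le> (\<Sum>r<M. norm (dft M (\<lambda>j. v j ^ n) r) ^ 4)"
      by (rule sum_power4_lower_bound) (use sum_norm_dft_square[OF M n1] bd C in auto)
    also have "\<dots> = Re (of_real (\<Sum>r<M. norm (dft M (\<lambda>j. v j ^ n) r) ^ 4))" by simp
    also have "\<dots> = Re ((\<Sum>q\<in>?Q. \<zeta> q ^ n) / of_nat M ^ 3)"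
      by (subst sum_norm_dft_power4[OF M])
         (simp add: \<zeta>_def case_prod_unfold power_mult_distrib)
    also have "\<dots> = Re (\<Sum>q\<in>?Q. \<zeta> q ^ n) / real M ^ 3"
      by (simp only: Re_divide_of_nat of_nat_power[symmetric])
    finally show ?thesis using M by (simp add: field_simps)
  qed
  have "(\<lambda>N. \<Sum>q\<in>?Q. (\<Sum>n<N. \<zeta> q ^ n) / of_nat N) \<longlonglongrightarrow> (\<Sum>q\<in>?Q. if \<zeta> q = 1 then 1 else 0)"
    by (intro tendsto_sum cesaro_unimodular_powers n\<zeta>)
  hence lim: "(\<lambda>N. Re (\<Sum>q\<in>?Q. (\<Sum>n<N. \<zeta> q ^ n) / of_nat N)) \<longlonglongrightarrow> Re (\<Sum>q\<in>?Q. if \<zeta> q = 1 then 1 else 0)"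
    by (rule tendsto_Re)
  have "real M ^ 3 / (8 * C\<^sup>2) \<le> Re (\<Sum>q\<in>?Q. if \<zeta> q = 1 then 1 else 0)"
  proof (rule tendsto_lowerbound[OF lim])
    show "\<forall>\<^sub>F N in sequentially. real M ^ 3 / (8 * C\<^sup>2) \<le> Re (\<Sum>q\<in>?Q. (\<Sum>n<N. \<zeta> q ^ n) / of_nat N)"
      using eventually_gt_at_top[of 0]
    proof eventually_elim
      case (elim N)
      have "(\<Sum>q\<in>?Q. (\<Sum>n<N. \<zeta> q ^ n) / of_nat N) = (\<Sum>n<N. \<Sum>q\<in>?Q. \<zeta> q ^ n) / of_nat N"
        by (subst sum.swap) (simp add: sum_divide_distrib)
      hence "Re (\<Sum>q\<in>?Q. (\<Sum>n<N. \<zeta> q ^ n) / of_nat N) = (\<Sum>n<N. Re (\<Sum>q\<in>?Q. \<zeta> q ^ n)) / real N"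
        by (simp only: Re_divide_of_nat Re_sum)
      moreover have "(\<Sum>n<N. Re (\<Sum>q\<in>?Q. \<zeta> q ^ n)) \<ge> (\<Sum>n<N. real M ^ 3 / (8 * C\<^sup>2))"
        by (intro sum_mono lower)
      ultimately show ?case
        using elim by (simp only: pos_le_divide_eq of_nat_0_less_iff) (simp add: mult.commute)
    qed
  qed simp
  also have "(\<Sum>q\<in>?Q. if \<zeta> q = 1 then 1 else (0::complex)) = of_nat (card {q\<in>?Q. \<zeta> q = 1})"
    by (subst sum.inter_filter[symmetric]) auto
  also have "{q\<in>?Q. \<zeta> q = 1} = {((x, x'), (y, y')) \<in> ?Q. v x * v x' = v y * v y'}"
  proof -
    \<comment> \<open>For a unimodular number the conjugate is the inverse.\<close>
    have "a * cnj b = 1 \<longleftrightarrow> a = b" if "norm b = 1" for a b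
    proof -
      have bb: "b * cnj b = 1" using that by (simp add: complex_norm_square[symmetric])
      hence ab: "a = a * cnj b * b" by (simp add: mult.assoc mult.commute[of "cnj b"])
      show ?thesis
      proof
        assume "a * cnj b = 1"
        thus "a = b" using ab by simp
      qed (use bb in simp)
    qed
    moreover have "norm (v y * v y') = 1" for y y' using v by (simp add: norm_mult)
    ultimately show ?thesis by (auto simp: \<zeta>_def simp del: complex_cnj_mult)
  qed
  finally show ?thesis by simp
qed

section \<open>Absolutely convergent power series\<close>

text \<open>The one-variable analogue of membership in the algebra, with the coefficients named;
  values of \<open>F\<close> off the closed disc are left free.\<close>

definition abs_power_series :: "(nat \<Rightarrow> complex) \<Rightarrow> (complex \<Rightarrow> complex) \<Rightarrow> bool" where
  "abs_power_series q F \<longleftrightarrow> summable (\<lambda>k. norm (q k)) \<and> (\<forall>x. norm x \<le> 1 \<longrightarrow> (\<lambda>k. q k * x ^ k) sums F x)"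

lemma abs_power_series_continuous:
  assumes "abs_power_series q F"
  shows "continuous_on (cball 0 1) F"
proof -
  have "uniform_limit (cball 0 1) (\<lambda>n x. \<Sum>k<n. q k * x ^ k) (\<lambda>x. \<Sum>k. q k * x ^ k) sequentially"
  proof (rule Weierstrass_m_test)
    show "norm (q k * x ^ k) \<le> norm (q k)" if "x \<in> cball 0 1" for k x
      using that by (auto simp: norm_mult norm_power intro!: mult_left_le power_le_one)
  qed (use assms in \<open>simp add: abs_power_series_def\<close>)
  hence "continuous_on (cball 0 1) (\<lambda>x. \<Sum>k. q k * x ^ k)"
    by (rule uniform_limit_theorem[rotated]) (auto intro!: continuous_intros always_eventually)
  moreover have "(\<Sum>k. q k * x ^ k) = F x" if "x \<in> cball 0 1" for x
    using that assms sums_unique[of "\<lambda>k. q k * x ^ k" "F x"] by (simp add: abs_power_series_def)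
  ultimately show ?thesis by (rule continuous_on_eq)
qed

lemma abs_power_series_holomorphic:
  assumes "abs_power_series q F"
  shows "F holomorphic_on ball 0 1"
  by (rule power_series_holomorphic[of 0 1 q]) (use assms in \<open>auto simp: abs_power_series_def\<close>)

lemma abs_power_series_diff:
  assumes "abs_power_series p F" "abs_power_series q G"
  shows "abs_power_series (\<lambda>k. p k - q k) (\<lambda>x. F x - G x)"
proof -
  have "summable (\<lambda>k. norm (p k - q k))"
    by (rule summable_norm_comparison_test[where f = "\<lambda>k. p k - q k" and g = "\<lambda>k. norm (p k) + norm (q k)"])
       (use assms in \<open>auto simp: abs_power_series_def intro!: exI[of _ 0] norm_triangle_ineq4 summable_add\<close>)
  moreover have "(\<lambda>k. (p k - q k) * x ^ k) sums (F x - G x)" if "norm x \<le> 1" for x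
    using sums_diff[of "\<lambda>k. p k * x ^ k" "F x" "\<lambda>k. q k * x ^ k" "G x"] assms that
    by (auto simp: abs_power_series_def left_diff_distrib)
  ultimately show ?thesis by (simp add: abs_power_series_def)
qed

lemma abs_power_series_cmult:
  assumes "abs_power_series q F"
  shows "abs_power_series (\<lambda>k. c * q k) (\<lambda>x. c * F x)"
  using assms by (auto simp: abs_power_series_def norm_mult mult.assoc intro!: summable_mult sums_mult)

lemma abs_power_series_sum:
  assumes "finite I" "\<And>i. i \<in> I \<Longrightarrow> abs_power_series (q i) (F i)"
  shows "abs_power_series (\<lambda>k. \<Sum>i\<in>I. q i k) (\<lambda>x. \<Sum>i\<in>I. F i x)"
  using assms
proof (induction I rule: finite_induct)
  case empty
  show ?case by (simp add: abs_power_series_def)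
next
  case (insert i I)
  have "abs_power_series (\<lambda>k. q i k - (-1) * (\<Sum>i\<in>I. q i k)) (\<lambda>x. F i x - (-1) * (\<Sum>i\<in>I. F i x))"
    by (intro abs_power_series_diff abs_power_series_cmult insert) auto
  thus ?case using insert by simp
qed

lemma abs_power_series_dilate:
  assumes "abs_power_series q F" "norm c \<le> 1"
  shows "abs_power_series (\<lambda>k. q k * c ^ k) (\<lambda>x. F (c * x))"
proof -
  have "summable (\<lambda>k. norm (q k * c ^ k))"
    by (rule summable_norm_comparison_test[where g = "\<lambda>k. norm (q k)"])
       (use assms in \<open>auto simp: abs_power_series_def norm_mult norm_power intro!: exI[of _ 0] mult_left_le power_le_one\<close>)
  moreover have "(\<lambda>k. q k * c ^ k * x ^ k) sums F (c * x)" if "norm x \<le> 1" for x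
  proof -
    have "norm (c * x) \<le> 1" using that assms(2) by (simp add: norm_mult mult_le_one)
    hence "(\<lambda>k. q k * (c * x) ^ k) sums F (c * x)" using assms(1) unfolding abs_power_series_def by blast
    thus ?thesis by (simp add: power_mult_distrib mult.assoc)
  qed
  ultimately show ?thesis by (simp add: abs_power_series_def)
qed

text \<open>Aliasing: on the \<open>M\<close>-th roots of unity, powers with congruent exponents
  coincide, so the discrete coefficient at \<open>r\<close> collects all \<open>q l\<close> with
  \<open>l\<close> congruent to \<open>r\<close>.\<close>

lemma dft_abs_power_series:
  assumes "abs_power_series q F" "M > 0"
  shows "(\<lambda>l. if int M dvd (int l - int r) then q l else 0) sums dft M (\<lambda>j. F (unity_root M (int j))) r"
proof -
  have "(\<lambda>l. (\<Sum>j<M. (q l * unity_root M (int j) ^ l) * unity_root M (- (int j * int r))) / of_nat M) sums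
      dft M (\<lambda>j. F (unity_root M (int j))) r"
    unfolding dft_def using assms(1)
    by (intro sums_divide sums_sum sums_mult2) (auto simp: abs_power_series_def)
  moreover have "(\<Sum>j<M. (q l * unity_root M (int j) ^ l) * unity_root M (- (int j * int r))) / of_nat M =
      (if int M dvd (int l - int r) then q l else 0)" for l
  proof -
    have "(\<Sum>j<M. (q l * unity_root M (int j) ^ l) * unity_root M (- (int j * int r))) =
        (\<Sum>j<M. q l * unity_root M ((int l - int r) * int j))"
      by (intro sum.cong refl)
         (simp add: unity_root_power unity_root_add[symmetric] algebra_simps)
    thus ?thesis using assms(2) by (simp add: sum_distrib_left[symmetric] sum_unity_root)
  qed
  ultimately show ?thesis by simp
qed

lemma norm_dft_le:
  assumes "M > 0" "\<And>j. norm (v j) \<le> B"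
  shows "norm (dft M v r) \<le> B"
proof -
  have "norm (\<Sum>j<M. v j * unity_root M (- (int j * int r))) \<le> (\<Sum>j<M. B)"
    by (rule sum_norm_le) (use assms in \<open>simp add: norm_mult\<close>)
  thus ?thesis using assms(1) by (simp add: dft_def norm_divide field_simps)
qed

text \<open>A Cauchy estimate on the unit circle itself, obtained without integration: for M > k the
  discrete coefficient at \<open>k\<close> is bounded by \<open>B\<close> and differs from
  \<open>q k\<close> only by aliased terms of index at least M, whose total tends to 0.\<close>

lemma abs_power_series_coeff_bound:
  assumes q: "abs_power_series q F" and B: "\<And>x. norm x = 1 \<Longrightarrow> norm (F x) \<le> B"
  shows "norm (q k) \<le> B"
proof -
  have sq: "summable (\<lambda>l. norm (q l))" using q by (simp add: abs_power_series_def)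
  have lim: "(\<lambda>M. B + (\<Sum>l. norm (q (l + M)))) \<longlonglongrightarrow> B + 0"
    by (intro tendsto_intros suminf_exist_split2[OF sq])
  have "norm (q k) \<le> B + (\<Sum>l. norm (q (l + M)))" if M: "M > k" for M
  proof -
    let ?t = "\<lambda>l. if int M dvd (int l - int k) then q l else 0"
    let ?d = "dft M (\<lambda>j. F (unity_root M (int j))) k"
    have s: "?t sums ?d" by (rule dft_abs_power_series[OF q]) (use M in simp)
    have split: "?d = (\<Sum>l. ?t (l + M)) + (\<Sum>l<M. ?t l)"
      using suminf_split_initial_segment[of ?t M] s by (simp add: sums_iff)
    have "(\<Sum>l<M. ?t l) = (\<Sum>l<M. if l = k then q l else 0)"
    proof (intro sum.cong refl)
      fix l assume "l \<in> {..<M}"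
      thus "?t l = (if l = k then q l else 0)"
        using M by (auto simp: mod_eq_dvd_iff[symmetric])
    qed
    also have "\<dots> = q k" using M by simp
    finally have "q k = ?d - (\<Sum>l. ?t (l + M))" using split by simp
    hence "norm (q k) \<le> norm ?d + norm (\<Sum>l. ?t (l + M))" by (simp add: norm_triangle_ineq4)
    moreover have "norm ?d \<le> B" by (rule norm_dft_le) (use M B in auto)
    moreover have "norm (\<Sum>l. ?t (l + M)) \<le> (\<Sum>l. norm (q (l + M)))"
      by (rule norm_suminf_le) (use summable_ignore_initial_segment[OF sq] in auto)
    ultimately show ?thesis by linarith
  qed
  hence "eventually (\<lambda>M. norm (q k) \<le> B + (\<Sum>l. norm (q (l + M)))) sequentially"
    using eventually_gt_at_top[of k] by (rule eventually_mono[rotated])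
  thus ?thesis using tendsto_lowerbound[OF lim] by simp
qed

lemma abs_power_series_unique:
  assumes "abs_power_series p F" "abs_power_series q F'" "\<And>x. norm x = 1 \<Longrightarrow> F x = F' x"
  shows "p k = q k"
  using abs_power_series_coeff_bound[OF abs_power_series_diff[OF assms(1,2)], of 0 k] assms(3) by simp

text \<open>Every index \<open>l\<close> falls into exactly one residue class, so aliasing cannot
  increase the l1-norm; the bound is uniform in \<open>M\<close>.\<close>

lemma sum_norm_dft_le:
  assumes q: "abs_power_series q F" and M: "M > 0"
  shows "(\<Sum>r<M. norm (dft M (\<lambda>j. F (unity_root M (int j))) r)) \<le> (\<Sum>l. norm (q l))"
proof -
  have sq: "summable (\<lambda>l. norm (q l))" using q by (simp add: abs_power_series_def)
  let ?t = "\<lambda>r l. if int M dvd (int l - int r) then q l else 0"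
  have sumt: "summable (\<lambda>l. norm (?t r l))" for r
    by (rule summable_comparison_test[OF _ sq]) auto
  have "(\<Sum>r<M. norm (dft M (\<lambda>j. F (unity_root M (int j))) r)) \<le> (\<Sum>r<M. \<Sum>l. norm (?t r l))"
  proof (rule sum_mono)
    fix r
    have "dft M (\<lambda>j. F (unity_root M (int j))) r = (\<Sum>l. ?t r l)"
      using dft_abs_power_series[OF q M] by (rule sums_unique)
    thus "norm (dft M (\<lambda>j. F (unity_root M (int j))) r) \<le> (\<Sum>l. norm (?t r l))"
      using summable_norm[OF sumt] by simp
  qed
  also have "\<dots> = (\<Sum>l. \<Sum>r<M. norm (?t r l))"
    by (rule suminf_sum[symmetric]) (rule sumt)
  also have "(\<lambda>l. \<Sum>r<M. norm (?t r l)) = (\<lambda>l. norm (q l))"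
  proof
    fix l
    have "(\<Sum>r<M. norm (?t r l)) = (\<Sum>r<M. if r = l mod M then norm (q l) else 0)"
    proof (intro sum.cong refl)
      fix r assume "r \<in> {..<M}"
      hence "int M dvd (int l - int r) \<longleftrightarrow> r = l mod M"
        by (auto simp: mod_eq_dvd_iff[symmetric] zmod_int[symmetric])
      thus "norm (?t r l) = (if r = l mod M then norm (q l) else 0)" by auto
    qed
    also have "\<dots> = norm (q l)" using M by simp
    finally show "(\<Sum>r<M. norm (?t r l)) = norm (q l)" .
  qed
  finally show ?thesis .
qed

section \<open>Power-bounded unimodular series\<close>

text \<open>For fixed x' and y, the congruence gives y' from x by multiplying the sample point by
  the constant \<open>?c x' y\<close>, and the multiplicative condition becomes a polynomial
  equation in the sample point of x. It has at most deg P + deg Q solutions unless it is an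
  identity, which forces \<open>?c x' y ^ (l - k) = 1\<close> and so leaves at most l - k values of
  x' for each y.\<close>

lemma card_multiplicative_quadruples_le:
  assumes G: "abs_power_series p G" and uni: "\<And>x. norm x = 1 \<Longrightarrow> norm (G x) = 1"
    and kl: "k < l" "p k \<noteq> 0" "p l \<noteq> 0"
    and PQ: "\<And>x. norm x = 1 \<Longrightarrow> poly Q x \<noteq> 0 \<and> G x = poly P x / poly Q x" and M: "M > 0"
  shows "card {((x, x'), (y, y')) \<in> additive_quadruples M.
            G (unity_root M (int x)) * G (unity_root M (int x')) = G (unity_root M (int y)) * G (unity_root M (int y'))}
         \<le> M\<^sup>2 * (degree P + degree Q + (l - k))" (is "card ?E \<le> _")
proof -
  let ?u = "\<lambda>j. unity_root M (int j)" and ?c = "\<lambda>x' y. unity_root M (int x' - int y)"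
  let ?K = "degree P + degree Q"
  define S where "S x' y = {x\<in>{..<M}. G (?u x) * G (?u x') = G (?u y) * G (?u x * ?c x' y)}" for x' y
  have Gnz: "G x \<noteq> 0" if "norm x = 1" for x using uni[OF that] by auto
  \<comment> \<open>In the exceptional case the trivial bound M is used.\<close>
  have S_le: "card (S x' y) \<le> ?K + (if ?c x' y ^ (l - k) = 1 then M else 0)" for x' y
  proof (cases "?c x' y ^ (l - k) = 1")
    case True
    have "card (S x' y) \<le> card {..<M}" unfolding S_def by (rule card_mono) auto
    thus ?thesis using True by simp
  next
    case False
    let ?c' = "?c x' y"
    \<comment> \<open>\<open>R\<close> is the equation G(x) G(u_x') = G(u_y) G(c x) after clearing
      denominators.\<close>
    define R where "R = smult (poly P (?u x') * poly Q (?u y)) (P * pcompose Q [:0, ?c':]) -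
                        smult (poly P (?u y) * poly Q (?u x')) (Q * pcompose P [:0, ?c':])"
    have R_iff: "poly R x = 0 \<longleftrightarrow> G x * G (?u x') = G (?u y) * G (x * ?c')" if "norm x = 1" for x
    proof -
      have "norm (x * ?c') = 1" using that by (simp add: norm_mult)
      hence nz: "poly Q x \<noteq> 0" "poly Q (x * ?c') \<noteq> 0" "poly Q (?u y) \<noteq> 0" "poly Q (?u x') \<noteq> 0"
        and eqs: "G x = poly P x / poly Q x" "G (x * ?c') = poly P (x * ?c') / poly Q (x * ?c')"
         "G (?u y) = poly P (?u y) / poly Q (?u y)" "G (?u x') = poly P (?u x') / poly Q (?u x')"
        using PQ that by auto
      show ?thesis unfolding eqs using nz
        by (simp add: R_def poly_pcompose field_simps)
    qed
    \<comment> \<open>If \<open>R\<close> were zero, the functional equation would hold on the whole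
      circle. Comparing Taylor coefficients at the two exponents \<open>k\<close> and
      \<open>l\<close>, where \<open>p\<close> is nonzero, then gives c^k = c^l.\<close>
    have "R \<noteq> 0"
    proof
      assume "R = 0"
      hence eq: "G (?u x') * G x = G (?u y) * G (?c' * x)" if "norm x = 1" for x
        using R_iff[OF that] by (simp add: mult.commute)
      have cf: "G (?u x') * p i = G (?u y) * (p i * ?c' ^ i)" for i
        by (rule abs_power_series_unique[OF abs_power_series_cmult[OF G]
              abs_power_series_cmult[OF abs_power_series_dilate[OF G]]]) (use eq in auto)
      have i: "G (?u x') = G (?u y) * ?c' ^ i" if "p i \<noteq> 0" for i
      proof -
        have "(G (?u x') - G (?u y) * ?c' ^ i) * p i = 0" using cf[of i] by (simp add: algebra_simps)
        thus ?thesis using that by simp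
      qed
      have "G (?u y) * ?c' ^ k = G (?u y) * ?c' ^ l"
        by (rule trans[OF i[OF kl(2), symmetric] i[OF kl(3)]])
      hence "?c' ^ k = ?c' ^ l" using Gnz[of "?u y"] by simp
      also have "\<dots> = ?c' ^ k * ?c' ^ (l - k)" using kl by (simp flip: power_add)
      finally have "?c' ^ (l - k) = 1" by simp
      thus False using False by blast
    qed
    have "card (S x' y) = card (?u ` S x' y)"
      using inj_on_unity_root[of M 0] by (intro card_image[symmetric]) (auto simp: S_def inj_on_def)
    also have "\<dots> \<le> card {x. poly R x = 0}"
      by (rule card_mono[OF poly_roots_finite[OF \<open>R \<noteq> 0\<close>]]) (auto simp: S_def R_iff)
    also have "\<dots> \<le> degree R" by (rule card_poly_roots_bound[OF \<open>R \<noteq> 0\<close>])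
    also have "\<dots> \<le> ?K"
    proof -
      have d: "degree (pcompose f [:0, ?c':]) \<le> degree f" for f :: "complex poly"
        using degree_pcompose_le[of f "[:0, ?c':]"] by simp
      have "degree (P * pcompose Q [:0, ?c':]) \<le> ?K" "degree (Q * pcompose P [:0, ?c':]) \<le> ?K"
        using degree_mult_le[of P "pcompose Q [:0, ?c':]"] degree_mult_le[of Q "pcompose P [:0, ?c':]"] d[of P] d[of Q]
        by linarith+
      thus ?thesis unfolding R_def
        by (intro degree_diff_le) (meson degree_smult_le order_trans)+
    qed
    finally show ?thesis using False by simp
  qed
  have cnt: "card {x'\<in>{..<M}. ?c x' y ^ (l - k) = 1} \<le> l - k" for y
  proof -
    have "card {x'\<in>{..<M}. ?c x' y ^ (l - k) = 1} = card ((\<lambda>x'. ?c x' y) ` {x'\<in>{..<M}. ?c x' y ^ (l - k) = 1})"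
      using inj_on_unity_root[of M "- int y"] by (intro card_image[symmetric]) (auto simp: inj_on_def)
    also have "\<dots> \<le> card {z::complex. z ^ (l - k) = 1}"
      by (rule card_mono) (use kl finite_roots_unity[of "l - k"] in auto)
    also have "\<dots> \<le> l - k" using kl by (intro card_roots_unity) simp
    finally show ?thesis .
  qed
  have fS: "finite (S x' y)" for x' y by (simp add: S_def)
  have "card ?E \<le> card (SIGMA y:{..<M}. SIGMA x':{..<M}. S x' y)"
  proof (rule card_inj_on_le[of "\<lambda>((x, x'), (y, y')). (y, x', x)"])
    \<comment> \<open>The dropped entry y' is determined by the others modulo M.\<close>
    show "inj_on (\<lambda>((x, x'), (y, y')). (y, x', x)) ?E"
    proof (rule inj_onI, clarsimp)
      fix x x' y y1 y2
      assume a: "((x, x'), y, y1) \<in> additive_quadruples M" "((x, x'), y, y2) \<in> additive_quadruples M"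
      hence "int M dvd ((int x + int x' - (int y + int y1)) - (int x + int x' - (int y + int y2)))"
        by (intro dvd_diff[of _ "int x + int x' - (int y + int y1)"]) (auto simp: additive_quadruples_def)
      hence "int M dvd (int y2 - int y1)" by simp
      hence "int y2 mod int M = int y1 mod int M" by (simp add: mod_eq_dvd_iff)
      thus "y1 = y2" using a by (auto simp: additive_quadruples_def)
    qed
    show "(\<lambda>((x, x'), (y, y')). (y, x', x)) ` ?E \<subseteq> (SIGMA y:{..<M}. SIGMA x':{..<M}. S x' y)"
    proof clarsimp
      fix x x' y y'
      assume a: "((x, x'), y, y') \<in> additive_quadruples M" "G (?u x) * G (?u x') = G (?u y) * G (?u y')"
      have "int M dvd (int y' - (int x + (int x' - int y)))"
        using a(1) by (subst dvd_diff_commute) (simp add: additive_quadruples_def algebra_simps)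
      hence "?u y' = ?u x * ?c x' y"
        using unity_root_eq_iff[OF M] by (simp add: unity_root_add[symmetric])
      thus "y < M \<and> x' < M \<and> x \<in> S x' y" using a by (auto simp: additive_quadruples_def S_def)
    qed
    show "finite (SIGMA y:{..<M}. SIGMA x':{..<M}. S x' y)" using fS by auto
  qed
  also have "\<dots> = (\<Sum>y<M. \<Sum>x'<M. card (S x' y))"
    using fS by (simp add: card_SigmaI)
  also have "\<dots> \<le> (\<Sum>y<M. \<Sum>x'<M. ?K + (if ?c x' y ^ (l - k) = 1 then M else 0))"
    by (intro sum_mono S_le)
  also have "\<dots> = (\<Sum>y<M. M * ?K + M * card {x'\<in>{..<M}. ?c x' y ^ (l - k) = 1})"
    by (simp add: sum.distrib sum.If_cases Int_def conj_commute mult.commute)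
  also have "\<dots> \<le> (\<Sum>y<M. M * ?K + M * (l - k))"
    by (intro sum_mono add_left_mono mult_left_mono cnt) auto
  also have "\<dots> = M\<^sup>2 * (?K + (l - k))" by (simp add: power2_eq_square ring_distribs)
  finally show ?thesis .
qed

text \<open>With two nonzero coefficients, the number of multiplicative quadruples would be at least
  a constant times M^3 and at most a constant times M^2, which is impossible for large M.\<close>

lemma bounded_powers_imp_coeff_unique:
  assumes G: "abs_power_series p G" and uni: "\<And>x. norm x = 1 \<Longrightarrow> norm (G x) = 1"
    and pw: "\<And>n. abs_power_series (a n) (\<lambda>x. G x ^ n)" and bd: "\<And>n. (\<Sum>k. norm (a n k)) \<le> C"
    and nz: "p k \<noteq> 0" "p l \<noteq> 0"
  shows "k = l"
proof -
  have False if kl: "k < l" and nz: "p k \<noteq> 0" "p l \<noteq> 0" for k l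
  proof -
    obtain P Q :: "complex poly" where PQ: "\<And>x. norm x = 1 \<Longrightarrow> poly Q x \<noteq> 0 \<and> G x = poly P x / poly Q x"
      using circle_unimodular_imp_rational[OF abs_power_series_continuous[OF G] abs_power_series_holomorphic[OF G] uni]
      by blast
    \<comment> \<open>The maximum with 1 only secures positivity, which the lower count
      requires.\<close>
    define D where "D = max C 1"
    define K where "K = degree P + degree Q + (l - k)"
    obtain M :: nat where M': "real M > 8 * D\<^sup>2 * real K" using reals_Archimedean2 by blast
    have D: "D > 0" by (simp add: D_def)
    have "0 \<le> 8 * D\<^sup>2 * real K" by simp
    hence M: "M > 0" using M' by linarith
    let ?v = "\<lambda>j. G (unity_root M (int j))"
    have "(\<Sum>r<M. norm (dft M (\<lambda>j. ?v j ^ n) r)) \<le> D" for n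
      using sum_norm_dft_le[OF pw[of n] M] bd[of n] by (simp add: D_def)
    hence "real M ^ 3 / (8 * D\<^sup>2) \<le> real (card {((x, x'), (y, y')) \<in> additive_quadruples M. ?v x * ?v x' = ?v y * ?v y'})"
      by (intro card_multiplicative_quadruples_ge M D) (auto simp: uni)
    also have "\<dots> \<le> real (M\<^sup>2 * K)"
      unfolding K_def using card_multiplicative_quadruples_le[OF G uni kl nz PQ M] by (simp only: of_nat_le_iff)
    finally have "real M ^ 3 \<le> (real M)\<^sup>2 * (8 * D\<^sup>2 * real K)" using D by (simp add: field_simps)
    also have "\<dots> < (real M)\<^sup>2 * real M" using M M' by (intro mult_strict_left_mono) auto
    finally show False by (simp add: power2_eq_square power3_eq_cube)
  qed
  thus ?thesis using nz by (meson linorder_neqE_nat)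
qed

text \<open>A gliding hump: if the norms were unbounded, a rapidly decreasing combination of the powers
  would fail to have absolutely summable coefficients.\<close>

lemma composition_imp_bounded_powers:
  assumes pw: "\<And>n. abs_power_series (a n) (\<lambda>x. G x ^ n)" and le1: "\<And>x. norm x = 1 \<Longrightarrow> norm (G x) \<le> 1"
    and comp: "\<And>w m. (\<And>j. 0 \<le> w j) \<Longrightarrow> summable w \<Longrightarrow>
        \<exists>q. abs_power_series q (\<lambda>x. \<Sum>j. complex_of_real (w j) * G x ^ m j)"
  shows "\<exists>C. \<forall>n. (\<Sum>k. norm (a n k)) \<le> C"
proof (rule ccontr)
  define S where "S n = (\<Sum>k. norm (a n k))" for n
  assume "\<not> ?thesis"
  hence unb: "\<exists>n. S n > C" for C unfolding S_def by (meson not_le)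
  have sa: "summable (\<lambda>k. norm (a n k))" for n using pw by (simp add: abs_power_series_def)
  \<comment> \<open>A state holds a weight \<open>w\<close>, an exponent \<open>m\<close>, a cutoff
    \<open>L\<close> and the total weighted norm \<open>K\<close> of the powers chosen so far.
    Halving keeps the later weights summable to at most twice the next one;
    \<open>w' * L \<le> 1/2\<close> keeps their effect on the first \<open>L\<close> coefficients
    bounded; the last condition makes the new power outweigh all earlier ones by n + 1 within its
    own cutoff.\<close>
  define Q :: "nat \<Rightarrow> real \<times> nat \<times> nat \<times> real \<Rightarrow> real \<times> nat \<times> nat \<times> real \<Rightarrow> bool"
    where "Q = (\<lambda>n (w, m, L, K) (w', m', L', K'). w' \<le> w / 2 \<and> w' * real L \<le> 1 / 2 \<and> K' = K + w' * S m' \<and>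
      real n + 1 + K \<le> w' * (\<Sum>k<L'. norm (a m' k)))"
  have "\<exists>f :: nat \<Rightarrow> real \<times> nat \<times> nat \<times> real. \<forall>n. (fst (f n) > 0 \<and> (n = 0 \<longrightarrow> f n = (1, 0, 0, S 0))) \<and> Q n (f n) (f (Suc n))"
  proof (rule dependent_nat_choice)
    show "\<exists>x :: real \<times> nat \<times> nat \<times> real. fst x > 0 \<and> ((0::nat) = 0 \<longrightarrow> x = (1, 0, 0, S 0))" by simp
    fix st :: "real \<times> nat \<times> nat \<times> real" and n :: nat
    assume st: "fst st > 0 \<and> (n = 0 \<longrightarrow> st = (1, 0, 0, S 0))"
    obtain w m L K where st': "st = (w, m, L, K)" by (cases st)
    \<comment> \<open>The two entries of the minimum give the two smallness conditions; the added 1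
      avoids a zero denominator at \<open>L = 0\<close>.\<close>
    define w' where "w' = min (w / 2) (1 / (2 * (real L + 1)))"
    have w': "w' > 0" "w' \<le> w / 2" using st by (auto simp: w'_def st')
    have "w' * real L \<le> 1 / (2 * (real L + 1)) * real L" by (intro mult_right_mono) (auto simp: w'_def)
    also have "\<dots> \<le> 1 / 2" by (simp add: field_simps)
    finally have w'L: "w' * real L \<le> 1 / 2" .
    \<comment> \<open>Only now is the exponent chosen, large in terms of the fixed weight; the
      cutoff follows by truncating its convergent norm series.\<close>
    obtain m' where m': "S m' > (real n + 1 + K) / w'" using unb by blast
    have "(\<lambda>L. \<Sum>k<L. norm (a m' k)) \<longlonglongrightarrow> S m'" unfolding S_def by (rule summable_LIMSEQ[OF sa])
    from order_tendstoD(1)[OF this m'] obtain L' where "(\<Sum>k<L'. norm (a m' k)) > (real n + 1 + K) / w'"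
      by (auto simp: eventually_at_top_linorder)
    hence "real n + 1 + K \<le> w' * (\<Sum>k<L'. norm (a m' k))" using w'(1) by (simp add: field_simps)
    thus "\<exists>y. (fst y > 0 \<and> (Suc n = 0 \<longrightarrow> y = (1, 0, 0, S 0))) \<and> Q n st y"
      using w' w'L by (intro exI[of _ "(w', m', L', K + w' * S m')"]) (simp add: Q_def st')
  qed
  then obtain f :: "nat \<Rightarrow> real \<times> nat \<times> nat \<times> real"
    where f0: "f 0 = (1, 0, 0, S 0)" and fpos: "\<And>n. fst (f n) > 0" and fQ: "\<And>n. Q n (f n) (f (Suc n))" by blast
  define w where "w n = fst (f n)" for n
  define m where "m n = fst (snd (f n))" for n
  define L where "L n = fst (snd (snd (f n)))" for n
  define K where "K n = snd (snd (snd (f n)))" for n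
  have feq: "f n = (w n, m n, L n, K n)" for n by (simp add: w_def m_def L_def K_def)
  have wpos: "w n > 0" for n using fpos by (simp add: w_def)
  have whalf: "w (Suc n) \<le> w n / 2" and wL: "w (Suc n) * real (L n) \<le> 1 / 2"
    and KS: "K (Suc n) = K n + w (Suc n) * S (m (Suc n))"
    and big: "real n + 1 + K n \<le> w (Suc n) * (\<Sum>k<L (Suc n). norm (a (m (Suc n)) k))" for n
    using fQ[of n] by (auto simp: feq Q_def)
  have K_eq: "K n = (\<Sum>i<Suc n. w i * S (m i))" for n
  proof (induction n)
    case 0
    show ?case using f0 feq[of 0] by simp
  qed (simp add: KS)
  have wgeo: "w (i + j) \<le> w j * (1 / 2) ^ i" for i j
  proof (induction i)
    case (Suc i)
    show ?case using whalf[of "i + j"] Suc by simp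
  qed simp
  have geo: "summable (\<lambda>i. w j * (1 / 2) ^ i)" for j by (intro summable_mult summable_geometric) simp
  have sw: "summable (\<lambda>i. w (i + j))" for j
    by (rule summable_comparison_test[OF _ geo[of j]]) (use wgeo in \<open>auto simp: abs_of_pos[OF wpos]\<close>)
  have tail: "(\<Sum>i. w (i + j)) \<le> 2 * w j" for j
  proof -
    have "(\<Sum>i. w (i + j)) \<le> (\<Sum>i. w j * (1 / 2) ^ i)" by (rule suminf_le[OF wgeo sw geo])
    also have "\<dots> = 2 * w j" by (subst suminf_mult) (auto simp: suminf_geometric)
    finally show ?thesis .
  qed
  obtain q where q: "abs_power_series q (\<lambda>x. \<Sum>j. complex_of_real (w j) * G x ^ m j)"
    using comp[of w m] wpos sw[of 0] less_imp_le by auto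
  have sq: "summable (\<lambda>k. norm (q k))" using q by (simp add: abs_power_series_def)
  \<comment> \<open>The omitted terms have sup norm at most 2 w_J on the circle, and the coefficient
    bound transfers this to every single coefficient.\<close>
  have coeff: "norm (q k - (\<Sum>i<J. w i * a (m i) k)) \<le> 2 * w J" for k J
  proof -
    have "abs_power_series (\<lambda>k. q k - (\<Sum>i<J. w i * a (m i) k))
       (\<lambda>x. (\<Sum>j. complex_of_real (w j) * G x ^ m j) - (\<Sum>i<J. complex_of_real (w i) * G x ^ m i))"
      by (intro abs_power_series_diff q abs_power_series_sum abs_power_series_cmult pw) auto
    moreover have "norm ((\<Sum>j. complex_of_real (w j) * G x ^ m j) - (\<Sum>i<J. complex_of_real (w i) * G x ^ m i)) \<le> 2 * w J"
      if x: "norm x = 1" for x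
    proof -
      have tle: "norm (complex_of_real (w j) * G x ^ m j) \<le> w j" for j
        using wpos[of j] le1[OF x] by (simp add: norm_mult norm_power power_le_one mult_left_le)
      have st: "summable (\<lambda>j. complex_of_real (w j) * G x ^ m j)"
        by (rule summable_comparison_test[OF _ sw[of 0]]) (use tle in auto)
      have "(\<Sum>j. complex_of_real (w j) * G x ^ m j) - (\<Sum>i<J. complex_of_real (w i) * G x ^ m i) =
         (\<Sum>i. complex_of_real (w (i + J)) * G x ^ m (i + J))"
        using suminf_split_initial_segment[OF st, of J] by simp
      also have "norm \<dots> \<le> (\<Sum>i. w (i + J))" by (rule norm_suminf_le[OF tle sw])
      finally show ?thesis using tail[of J] by linarith
    qed
    ultimately show ?thesis by (rule abs_power_series_coeff_bound)
  qed
  \<comment> \<open>Over the first \<open>L ?J\<close> coefficients, the hump exceeds the earlier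
    powers by n + 1 and the later ones cost at most 2 * (1/2) = 1, which leaves n.\<close>
  have "real n \<le> (\<Sum>k. norm (q k))" for n
  proof -
    let ?J = "Suc n"
    have pt: "norm (q k) \<ge> w ?J * norm (a (m ?J) k) - (\<Sum>i<?J. w i * norm (a (m i) k)) - 2 * w (Suc ?J)" for k
    proof -
      have "w ?J * a (m ?J) k = (\<Sum>i<Suc ?J. w i * a (m i) k) - (\<Sum>i<?J. w i * a (m i) k)" by simp
      hence "norm (w ?J * a (m ?J) k) \<le> norm (\<Sum>i<Suc ?J. w i * a (m i) k) + norm (\<Sum>i<?J. w i * a (m i) k)"
        by (metis norm_triangle_ineq4)
      moreover have "norm (\<Sum>i<?J. w i * a (m i) k) \<le> (\<Sum>i<?J. w i * norm (a (m i) k))"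
        by (rule sum_norm_le) (simp add: norm_mult abs_of_pos[OF wpos])
      moreover have "norm (\<Sum>i<Suc ?J. w i * a (m i) k) \<le> norm (q k) + 2 * w (Suc ?J)"
        using coeff[of k "Suc ?J"] norm_triangle_ineq3[of "q k" "\<Sum>i<Suc ?J. w i * a (m i) k"] by linarith
      moreover have "norm (w ?J * a (m ?J) k) = w ?J * norm (a (m ?J) k)" using wpos[of ?J] by (simp add: norm_mult)
      ultimately show ?thesis by linarith
    qed
    have "real n + 1 + K n - K n - 2 * w (Suc ?J) * real (L ?J) \<le>
       w ?J * (\<Sum>k<L ?J. norm (a (m ?J) k)) - (\<Sum>i<?J. w i * (\<Sum>k<L ?J. norm (a (m i) k))) - 2 * w (Suc ?J) * real (L ?J)"
    proof -
      have "(\<Sum>i<?J. w i * (\<Sum>k<L ?J. norm (a (m i) k))) \<le> K n"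
        unfolding K_eq S_def using wpos
        by (intro sum_mono mult_left_mono sum_le_suminf sa) (auto intro: less_imp_le)
      thus ?thesis using big[of n] by linarith
    qed
    also have "\<dots> = (\<Sum>k<L ?J. w ?J * norm (a (m ?J) k) - (\<Sum>i<?J. w i * norm (a (m i) k)) - 2 * w (Suc ?J))"
      by (simp only: sum_subtractf sum_distrib_left sum.swap[of _ "{..<?J}"] sum_constant card_lessThan) simp
    also have "\<dots> \<le> (\<Sum>k<L ?J. norm (q k))" by (intro sum_mono pt)
    also have "\<dots> \<le> (\<Sum>k. norm (q k))" by (intro sum_le_suminf sq) auto
    finally show ?thesis using wL[of ?J] by simp
  qed
  thus False by (meson reals_Archimedean2 not_le)
qed

section \<open>Series in infinitely many variables\<close>

text \<open>Regrouping an absolutely convergent sum by the value of \<open>p\<close>. It is used to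
  merge equal exponents and to sort a series by its degree in one variable.\<close>

lemma abs_summable_fibers:
  fixes f :: "'a \<Rightarrow> 'b::banach"
  assumes f: "f abs_summable_on J" and p: "p ` J \<subseteq> B"
  shows "(\<lambda>b. \<Sum>\<^sub>\<infinity>j\<in>{j\<in>J. p j = b}. f j) abs_summable_on B"
    and "(\<Sum>\<^sub>\<infinity>b\<in>B. \<Sum>\<^sub>\<infinity>j\<in>{j\<in>J. p j = b}. f j) = infsum f J"
proof -
  let ?S = "SIGMA b:B. {j\<in>J. p j = b}" and ?g = "\<lambda>x. f (snd x)"
  have bij: "bij_betw snd ?S J"
    unfolding bij_betw_def using p by (force simp: inj_on_def image_iff)
  have g: "?g abs_summable_on ?S"
    using summable_on_reindex_bij_betw[OF bij, of "\<lambda>j. norm (f j)"] f by simp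
  hence gb: "\<And>b. b \<in> B \<Longrightarrow> f abs_summable_on {j\<in>J. p j = b}"
    and gB: "(\<lambda>b. \<Sum>\<^sub>\<infinity>j\<in>{j\<in>J. p j = b}. norm (f j)) abs_summable_on B"
    unfolding Infinite_Sum.abs_summable_on_Sigma_iff by auto
  show "(\<lambda>b. \<Sum>\<^sub>\<infinity>j\<in>{j\<in>J. p j = b}. f j) abs_summable_on B"
  proof (rule Infinite_Sum.abs_summable_on_comparison_test[OF gB])
    fix b assume "b \<in> B"
    show "norm (\<Sum>\<^sub>\<infinity>j\<in>{j\<in>J. p j = b}. f j) \<le> norm (\<Sum>\<^sub>\<infinity>j\<in>{j\<in>J. p j = b}. norm (f j))"
      using norm_infsum_bound[OF gb[OF \<open>b \<in> B\<close>]] by (simp add: infsum_nonneg)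
  qed
  have "?g summable_on ?S" using g by (rule abs_summable_summable)
  from infsum_Sigma_banach[OF this] 
  show "(\<Sum>\<^sub>\<infinity>b\<in>B. \<Sum>\<^sub>\<infinity>j\<in>{j\<in>J. p j = b}. f j) = infsum f J"
    using infsum_reindex_bij_betw[OF bij, of f] by simp
qed

section \<open>Monomials on the polydisc and slices in one variable\<close>

lemma monom_eq_prod:
  assumes "finite A" "{j. \<alpha> j \<noteq> 0} \<subseteq> A"
  shows "monom \<alpha> z = (\<Prod>j\<in>A. z j ^ \<alpha> j)"
  unfolding monom_def by (rule prod.mono_neutral_left) (use assms in auto)

lemma norm_monom_le:
  assumes "z \<in> polydisc"
  shows "norm (monom \<alpha> z) \<le> 1"
  using assms unfolding monom_def polydisc_def prod_norm[symmetric]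
  by (auto intro!: prod_le_1 simp: norm_power power_le_one)

lemma torus_subset_polydisc: "torus \<subseteq> polydisc"
  by (auto simp: torus_def polydisc_def)

lemma norm_monom_torus:
  assumes "z \<in> torus"
  shows "norm (monom \<alpha> z) = 1"
  using assms unfolding monom_def torus_def prod_norm[symmetric] by (simp add: norm_power)

lemma monom_scale:
  assumes "\<alpha> \<in> multi_idx"
  shows "monom \<alpha> (z(j := x * z j)) = x ^ \<alpha> j * monom \<alpha> z"
proof -
  let ?A = "insert j {i. \<alpha> i \<noteq> 0}"
  have fin: "finite ?A" using assms by (simp add: multi_idx_def)
  have eq: "monom \<alpha> y = y j ^ \<alpha> j * (\<Prod>i\<in>?A - {j}. y i ^ \<alpha> i)" for y
    by (subst monom_eq_prod[OF fin], blast, rule prod.remove[OF fin]) simp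
  have "(\<Prod>i\<in>?A - {j}. (z(j := x * z j)) i ^ \<alpha> i) = (\<Prod>i\<in>?A - {j}. z i ^ \<alpha> i)"
    by (rule prod.cong) auto
  thus ?thesis unfolding eq by (simp add: power_mult_distrib mult.assoc)
qed

lemma abs_summable_monom:
  assumes "c abs_summable_on J" "z \<in> polydisc"
  shows "(\<lambda>j. c j * monom (p j) z) abs_summable_on J"
  by (rule Infinite_Sum.abs_summable_on_comparison_test[OF assms(1)])
     (use norm_monom_le[OF assms(2)] in \<open>auto simp: norm_mult mult_left_le\<close>)

lemma abs_power_series_slice:
  assumes c: "c abs_summable_on A" and A: "A \<subseteq> multi_idx" and z: "z \<in> polydisc"
  shows "abs_power_series (\<lambda>k. \<Sum>\<^sub>\<infinity>\<alpha>\<in>{\<alpha>\<in>A. \<alpha> j = k}. c \<alpha> * monom \<alpha> z)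
           (\<lambda>x. \<Sum>\<^sub>\<infinity>\<alpha>\<in>A. c \<alpha> * monom \<alpha> (z(j := x * z j)))"
proof -
  let ?q = "\<lambda>k. \<Sum>\<^sub>\<infinity>\<alpha>\<in>{\<alpha>\<in>A. \<alpha> j = k}. c \<alpha> * monom \<alpha> z"
  have "?q abs_summable_on UNIV"
    by (rule abs_summable_fibers(1)[OF abs_summable_monom[OF c z]]) simp
  hence sq: "summable (\<lambda>k. norm (?q k))" by (rule summable_on_imp_summable)
  moreover have "(\<lambda>k. ?q k * x ^ k) sums (\<Sum>\<^sub>\<infinity>\<alpha>\<in>A. c \<alpha> * monom \<alpha> (z(j := x * z j)))" if x: "norm x \<le> 1" for x
  proof -
    let ?z = "z(j := x * z j)"
    have z': "?z \<in> polydisc" using z x by (auto simp: polydisc_def norm_mult mult_le_one)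
    note s = abs_summable_monom[OF c z', of "\<lambda>\<alpha>. \<alpha>"]
    have eq: "(\<Sum>\<^sub>\<infinity>\<alpha>\<in>{\<alpha>\<in>A. \<alpha> j = k}. c \<alpha> * monom \<alpha> ?z) = ?q k * x ^ k" for k
    proof -
      have "(\<Sum>\<^sub>\<infinity>\<alpha>\<in>{\<alpha>\<in>A. \<alpha> j = k}. c \<alpha> * monom \<alpha> ?z) = (\<Sum>\<^sub>\<infinity>\<alpha>\<in>{\<alpha>\<in>A. \<alpha> j = k}. (c \<alpha> * monom \<alpha> z) * x ^ k)"
        by (rule infsum_cong) (use A in \<open>auto simp: monom_scale mult_ac\<close>)
      thus ?thesis by (simp add: infsum_cmult_left')
    qed
    have "(\<lambda>k. ?q k * x ^ k) abs_summable_on UNIV"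
      using abs_summable_fibers(1)[OF s, of "\<lambda>\<alpha>. \<alpha> j" UNIV] by (simp add: eq)
    hence "(\<lambda>k. ?q k * x ^ k) summable_on UNIV" by (rule abs_summable_summable)
    hence "(\<lambda>k. ?q k * x ^ k) sums (\<Sum>\<^sub>\<infinity>k. ?q k * x ^ k)"
      by (intro has_sum_imp_sums has_sum_infsum)
    thus ?thesis using abs_summable_fibers(2)[OF s, of "\<lambda>\<alpha>. \<alpha> j" UNIV] by (simp add: eq)
  qed
  ultimately show ?thesis by (simp add: abs_power_series_def)
qed

lemma torus_scale: "z \<in> torus \<Longrightarrow> norm x = 1 \<Longrightarrow> z(j := x * z j) \<in> torus"
  by (auto simp: torus_def norm_mult)

text \<open>Variables are separated one at a time: by one-variable uniqueness, the part of the
  series whose exponents agree with \<kappa> in the first N places still vanishes on the torus. For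
  large N this part is the \<kappa>-term plus a piece of an arbitrarily small tail.\<close>

lemma coeffs_eq_0_if_vanishing_on_torus:
  assumes c: "c abs_summable_on A" and A: "A \<subseteq> multi_idx"
    and van: "\<And>z. z \<in> torus \<Longrightarrow> (\<Sum>\<^sub>\<infinity>\<alpha>\<in>A. c \<alpha> * monom \<alpha> z) = 0" and \<kappa>: "\<kappa> \<in> A"
  shows "c \<kappa> = 0"
proof -
  define B where "B N = {\<alpha>\<in>A. \<forall>i<N. \<alpha> i = \<kappa> i}" for N :: nat
  have cB: "c abs_summable_on B N" for N
    by (rule summable_on_subset_banach[OF c]) (auto simp: B_def)
  have vanB: "(\<Sum>\<^sub>\<infinity>\<alpha>\<in>B N. c \<alpha> * monom \<alpha> z) = 0" if "z \<in> torus" for N z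
    using that
  proof (induction N arbitrary: z)
    case 0
    thus ?case using van by (simp add: B_def)
  next
    case (Suc N)
    have "z \<in> polydisc" using Suc.prems torus_subset_polydisc by blast
    hence "abs_power_series (\<lambda>k. \<Sum>\<^sub>\<infinity>\<alpha>\<in>{\<alpha>\<in>B N. \<alpha> N = k}. c \<alpha> * monom \<alpha> z)
           (\<lambda>x. \<Sum>\<^sub>\<infinity>\<alpha>\<in>B N. c \<alpha> * monom \<alpha> (z(N := x * z N)))"
      by (intro abs_power_series_slice cB) (use A in \<open>auto simp: B_def\<close>)
    \<comment> \<open>The slice is zero on the circle, so the coefficient bound with B = 0 removes
      its coefficient of degree \<open>\<kappa> N\<close>.\<close>
    hence "norm (\<Sum>\<^sub>\<infinity>\<alpha>\<in>{\<alpha>\<in>B N. \<alpha> N = \<kappa> N}. c \<alpha> * monom \<alpha> z) \<le> 0"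
      by (rule abs_power_series_coeff_bound) (simp add: Suc.IH[OF torus_scale[OF Suc.prems]])
    moreover have "{\<alpha>\<in>B N. \<alpha> N = \<kappa> N} = B (Suc N)" by (auto simp: B_def less_Suc_eq)
    ultimately show ?case by simp
  qed
  have "norm (c \<kappa>) \<le> e" if "e > 0" for e :: real
  proof -
    obtain F where F: "finite F" "F \<subseteq> A" "dist (\<Sum>\<alpha>\<in>F. norm (c \<alpha>)) (\<Sum>\<^sub>\<infinity>\<alpha>\<in>A. norm (c \<alpha>)) \<le> e"
      using infsum_finite_approximation[OF c \<open>e > 0\<close>] by blast
    have cF: "c abs_summable_on (A - F)" by (rule summable_on_subset_banach[OF c]) auto
    have "(\<Sum>\<^sub>\<infinity>\<alpha>\<in>A - F. norm (c \<alpha>)) = (\<Sum>\<^sub>\<infinity>\<alpha>\<in>A. norm (c \<alpha>)) - (\<Sum>\<alpha>\<in>F. norm (c \<alpha>))"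
      using infsum_Un_disjoint[of "\<lambda>\<alpha>. norm (c \<alpha>)" F "A - F"] F cF by (simp add: Un_absorb1)
    hence tail: "(\<Sum>\<^sub>\<infinity>\<alpha>\<in>A - F. norm (c \<alpha>)) \<le> e" using F(3) by (simp add: dist_real_def)
    have "\<exists>i. \<alpha> i \<noteq> \<kappa> i" if "\<alpha> \<in> F - {\<kappa>}" for \<alpha> using that by auto
    then obtain i where i: "\<And>\<alpha>. \<alpha> \<in> F - {\<kappa>} \<Longrightarrow> \<alpha> (i \<alpha>) \<noteq> \<kappa> (i \<alpha>)" by metis
    \<comment> \<open>N lies beyond a place of disagreement with \<kappa> for each of the finitely
      many exponents in \<open>F\<close> other than \<kappa>.\<close>
    define N where "N = Suc (Max (insert 0 (i ` F)))"
    have iN: "i \<alpha> < N" if "\<alpha> \<in> F" for \<alpha>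
      unfolding N_def using F(1) that by (auto simp: less_Suc_eq_le intro!: Max_ge)
    have sub: "B N - {\<kappa>} \<subseteq> A - F"
    proof
      fix \<alpha> assume a: "\<alpha> \<in> B N - {\<kappa>}"
      have "\<alpha> \<notin> F"
      proof
        assume "\<alpha> \<in> F"
        hence "\<alpha> (i \<alpha>) \<noteq> \<kappa> (i \<alpha>)" "i \<alpha> < N" using i iN a by auto
        thus False using a by (auto simp: B_def)
      qed
      thus "\<alpha> \<in> A - F" using a by (auto simp: B_def)
    qed
    \<comment> \<open>At this point every monomial equals 1, so the coefficients themselves are
      summed.\<close>
    let ?one = "\<lambda>_::nat. 1::complex"
    have one: "?one \<in> torus" by (simp add: torus_def)
    have m1: "monom \<alpha> ?one = 1" for \<alpha> by (simp add: monom_def)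
    have cBk: "c abs_summable_on (B N - {\<kappa>})" by (rule summable_on_subset_banach[OF cF sub])
    have "0 = (\<Sum>\<^sub>\<infinity>\<alpha>\<in>B N. c \<alpha>)" using vanB[OF one, of N] by (simp add: m1)
    also have "B N = insert \<kappa> (B N - {\<kappa>})" using \<kappa> by (auto simp: B_def)
    also have "(\<Sum>\<^sub>\<infinity>\<alpha>\<in>insert \<kappa> (B N - {\<kappa>}). c \<alpha>) = c \<kappa> + (\<Sum>\<^sub>\<infinity>\<alpha>\<in>B N - {\<kappa>}. c \<alpha>)"
      by (rule infsum_insert[OF abs_summable_summable[OF cBk]]) simp
    finally have "norm (c \<kappa>) = norm (\<Sum>\<^sub>\<infinity>\<alpha>\<in>B N - {\<kappa>}. c \<alpha>)"
      by (simp add: add_eq_0_iff)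
    also have "\<dots> \<le> (\<Sum>\<^sub>\<infinity>\<alpha>\<in>B N - {\<kappa>}. norm (c \<alpha>))" by (rule norm_infsum_bound[OF cBk])
    also have "\<dots> \<le> (\<Sum>\<^sub>\<infinity>\<alpha>\<in>A - F. norm (c \<alpha>))" by (rule infsum_mono2[OF cBk cF sub]) auto
    finally show ?thesis using tail by linarith
  qed
  hence "norm (c \<kappa>) \<le> 0" by (rule field_le_epsilon[of _ 0, simplified])
  thus ?thesis by simp
qed

section \<open>Uniqueness of coefficients and computation of the norm\<close>

lemma represents_unique:
  assumes "represents c f" "represents d g" "\<And>z. z \<in> torus \<Longrightarrow> f z = g z" "\<alpha> \<in> multi_idx"
  shows "c \<alpha> = d \<alpha>"
proof -
  have c: "c abs_summable_on multi_idx" and d: "d abs_summable_on multi_idx"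
    using assms by (auto simp: represents_def)
  have "(\<lambda>\<alpha>. c \<alpha> - d \<alpha>) abs_summable_on multi_idx"
  proof (rule Infinite_Sum.abs_summable_on_comparison_test')
    show "(\<lambda>\<alpha>. norm (c \<alpha>) + norm (d \<alpha>)) summable_on multi_idx" by (rule summable_on_add[OF c d])
  qed (rule norm_triangle_ineq4)
  moreover have "(\<Sum>\<^sub>\<infinity>\<alpha>\<in>multi_idx. (c \<alpha> - d \<alpha>) * monom \<alpha> z) = 0" if "z \<in> torus" for z
  proof -
    have z: "z \<in> polydisc" using that torus_subset_polydisc by blast
    have "(\<Sum>\<^sub>\<infinity>\<alpha>\<in>multi_idx. (c \<alpha> - d \<alpha>) * monom \<alpha> z) =
        (\<Sum>\<^sub>\<infinity>\<alpha>\<in>multi_idx. c \<alpha> * monom \<alpha> z) - (\<Sum>\<^sub>\<infinity>\<alpha>\<in>multi_idx. d \<alpha> * monom \<alpha> z)"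
    proof -
      have sc: "(\<lambda>\<alpha>. c \<alpha> * monom \<alpha> z) summable_on multi_idx"
        and sd: "(\<lambda>\<alpha>. d \<alpha> * monom \<alpha> z) summable_on multi_idx"
        by (rule abs_summable_summable[OF abs_summable_monom[OF c z]],
            rule abs_summable_summable[OF abs_summable_monom[OF d z]])
      show ?thesis
        using infsum_add[OF sc summable_on_uminus[THEN iffD2, OF sd]]
        by (simp add: infsum_uminus left_diff_distrib)
    qed
    moreover have "f z = (\<Sum>\<^sub>\<infinity>\<alpha>\<in>multi_idx. c \<alpha> * monom \<alpha> z)" "g z = (\<Sum>\<^sub>\<infinity>\<alpha>\<in>multi_idx. d \<alpha> * monom \<alpha> z)"
      using assms(1,2) z unfolding represents_def by blast+
    ultimately show ?thesis using assms(3)[OF that] by simp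
  qed
  ultimately have "c \<alpha> - d \<alpha> = 0"
    by (rule coeffs_eq_0_if_vanishing_on_torus[OF _ order_refl _ assms(4)])
  thus ?thesis by simp
qed

text \<open>The family picked by \<open>SOME\<close> is determined only on \<open>multi_idx\<close>,
  which is exactly where the norm sums.\<close>

lemma A_norm_eq:
  assumes "represents c f"
  shows "A_norm f = (\<Sum>\<^sub>\<infinity>\<alpha>\<in>multi_idx. norm (c \<alpha>))"
proof -
  have "represents (SOME c. represents c f) f" using assms by (rule someI[of "\<lambda>c. represents c f"])
  hence "(SOME c. represents c f) \<alpha> = c \<alpha>" if "\<alpha> \<in> multi_idx" for \<alpha>
    using represents_unique[OF _ assms refl that] by blast
  thus ?thesis unfolding A_norm_def by (intro infsum_cong) simp
qed

text \<open>The exponents \<open>p j\<close> may repeat; the coefficient of a monomial is then the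
  sum over the fibre.\<close>

lemma represents_pushforward:
  assumes c: "c abs_summable_on J" and p: "p ` J \<subseteq> multi_idx"
  shows "represents (\<lambda>\<beta>. \<Sum>\<^sub>\<infinity>j\<in>{j\<in>J. p j = \<beta>}. c j) (\<lambda>z. \<Sum>\<^sub>\<infinity>j\<in>J. c j * monom (p j) z)"
  unfolding represents_def
proof (intro conjI ballI)
  show "(\<lambda>\<beta>. \<Sum>\<^sub>\<infinity>j\<in>{j\<in>J. p j = \<beta>}. c j) abs_summable_on multi_idx"
    by (rule abs_summable_fibers(1)[OF c p])
  fix z assume z: "z \<in> polydisc"
  have "(\<Sum>\<^sub>\<infinity>j\<in>{j\<in>J. p j = \<beta>}. c j * monom (p j) z) = (\<Sum>\<^sub>\<infinity>j\<in>{j\<in>J. p j = \<beta>}. c j) * monom \<beta> z" for \<beta>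
    unfolding infsum_cmult_left'[symmetric] by (rule infsum_cong) auto
  thus "(\<Sum>\<^sub>\<infinity>j\<in>J. c j * monom (p j) z) = (\<Sum>\<^sub>\<infinity>\<beta>\<in>multi_idx. (\<Sum>\<^sub>\<infinity>j\<in>{j\<in>J. p j = \<beta>}. c j) * monom \<beta> z)"
    using abs_summable_fibers(2)[OF abs_summable_monom[OF c z, of p] p] by simp
qed

section \<open>The components of the symbol\<close>

lemma abs_power_series_cong:
  assumes "abs_power_series q F" "\<And>x. norm x \<le> 1 \<Longrightarrow> F x = G x"
  shows "abs_power_series q G"
  using assms by (simp add: abs_power_series_def)

lemma represents_slice:
  assumes "represents c f" "z \<in> polydisc"
  shows "abs_power_series (\<lambda>k. \<Sum>\<^sub>\<infinity>\<alpha>\<in>{\<alpha>\<in>multi_idx. \<alpha> j = k}. c \<alpha> * monom \<alpha> z) (\<lambda>x. f (z(j := x * z j)))"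
proof (rule abs_power_series_cong[OF abs_power_series_slice[OF _ order_refl assms(2)]])
  show "c abs_summable_on multi_idx" using assms(1) by (simp add: represents_def)
  fix x :: complex assume "norm x \<le> 1"
  hence "z(j := x * z j) \<in> polydisc" using assms(2) by (auto simp: polydisc_def norm_mult mult_le_one)
  thus "(\<Sum>\<^sub>\<infinity>\<alpha>\<in>multi_idx. c \<alpha> * monom \<alpha> (z(j := x * z j))) = f (z(j := x * z j))"
    using assms(1) by (simp add: represents_def)
qed

lemma monom_single: "monom ((\<lambda>_. 0)(i := n)) z = z i ^ n"
  by (subst monom_eq_prod[of "{i}"]) auto

lemma single_in_multi_idx: "(\<lambda>_. 0)(i := n) \<in> multi_idx"
  unfolding multi_idx_def by (auto intro: finite_subset[of _ "{i}"])

lemma power_combination_in_A_plus: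
  fixes w :: "nat \<Rightarrow> real"
  assumes "\<And>j. 0 \<le> w j" "summable w"
  shows "(\<lambda>z. \<Sum>\<^sub>\<infinity>j. complex_of_real (w j) * z i ^ m j) \<in> A_plus"
proof -
  have "(\<lambda>j. complex_of_real (w j)) abs_summable_on UNIV"
    using assms by (simp add: summable_on_UNIV_nonneg_real_iff)
  from represents_pushforward[OF this, of "\<lambda>j. (\<lambda>_. 0)(i := m j)"] show ?thesis
    using single_in_multi_idx by (auto simp: A_plus_def monom_single)
qed

text \<open>Supplies the composition hypothesis of the gliding hump: a weighted combination of
  powers of the i-th coordinate lies in the algebra, hence so does its composition with \<phi>,
  which is then restricted to a slice.\<close>

lemma slice_composition:
  fixes w :: "nat \<Rightarrow> real"
  assumes disc: "\<phi> ` polydisc \<subseteq> polydisc" and comp: "\<forall>f\<in>A_plus. f \<circ> \<phi> \<in> A_plus"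
    and z: "z \<in> polydisc" and w: "\<And>j. 0 \<le> w j" "summable w"
  shows "\<exists>q. abs_power_series q (\<lambda>x. \<Sum>k. complex_of_real (w k) * \<phi> (z(j := x * z j)) i ^ m k)"
proof -
  let ?f = "\<lambda>z. \<Sum>\<^sub>\<infinity>k. complex_of_real (w k) * z i ^ m k"
  have "?f \<circ> \<phi> \<in> A_plus" using comp power_combination_in_A_plus[OF w, of i m] by blast
  then obtain c where "represents c (?f \<circ> \<phi>)" by (auto simp: A_plus_def)
  note q = represents_slice[OF this z, of j]
  show ?thesis
  proof (rule exI, rule abs_power_series_cong[OF q])
    fix x :: complex assume x: "norm x \<le> 1"
    let ?y = "\<phi> (z(j := x * z j))"
    have "z(j := x * z j) \<in> polydisc" using z x by (auto simp: polydisc_def norm_mult mult_le_one)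
    hence "?y \<in> polydisc" using disc by blast
    hence y: "norm (?y i) \<le> 1" by (simp add: polydisc_def)
    have le: "norm (complex_of_real (w k) * ?y i ^ m k) \<le> w k" for k
      using w(1)[of k] y by (simp add: norm_mult norm_power power_le_one mult_left_le)
    have "summable (\<lambda>k. norm (complex_of_real (w k) * ?y i ^ m k))"
      by (rule summable_comparison_test[OF _ w(2)]) (use le in auto)
    hence "(\<lambda>k. complex_of_real (w k) * ?y i ^ m k) summable_on UNIV" by (rule norm_summable_imp_summable_on)
    hence "(\<lambda>k. complex_of_real (w k) * ?y i ^ m k) sums ?f ?y" by (intro has_sum_imp_sums has_sum_infsum)
    thus "(?f \<circ> \<phi>) (z(j := x * z j)) = (\<Sum>k. complex_of_real (w k) * ?y i ^ m k)"
      by (simp add: sums_unique)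
  qed
qed

lemma slice_coeff_unique:
  assumes disc: "\<phi> ` polydisc \<subseteq> polydisc" and comp: "\<forall>f\<in>A_plus. f \<circ> \<phi> \<in> A_plus"
    and torus: "\<phi> ` torus \<subseteq> torus" and z: "z \<in> torus"
    and p: "abs_power_series p (\<lambda>x. \<phi> (z(j := x * z j)) i)" and nz: "p k \<noteq> 0" "p l \<noteq> 0"
  shows "k = l"
proof -
  let ?G = "\<lambda>x. \<phi> (z(j := x * z j)) i"
  have z': "z \<in> polydisc" using z torus_subset_polydisc by blast
  have uni: "norm (?G x) = 1" if "norm x = 1" for x
    using torus torus_scale[OF z that, of j] unfolding torus_def by blast
  have "\<exists>q. abs_power_series q (\<lambda>x. ?G x ^ n)" for n
  proof -
    \<comment> \<open>All weight at index 0 and constant exponent \<open>n\<close> turn the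
      combination into the single power.\<close>
    let ?w = "\<lambda>k. if k = (0::nat) then 1 else (0::real)"
    have "\<And>k. 0 \<le> ?w k" "summable ?w" by (auto intro: summable_finite[of "{0}"])
    from slice_composition[OF disc comp z' this, of j i "\<lambda>_. n"]
    obtain q where q: "abs_power_series q (\<lambda>x. \<Sum>k. complex_of_real (?w k) * ?G x ^ n)" by blast
    have "(\<Sum>k. complex_of_real (if k = (0::nat) then 1 else 0) * ?G x ^ n) = ?G x ^ n" for x
      using suminf_finite[of "{0::nat}" "\<lambda>k. complex_of_real (if k = (0::nat) then 1 else 0) * ?G x ^ n"] by simp
    thus ?thesis using q by auto
  qed
  then obtain a where a: "\<And>n. abs_power_series (a n) (\<lambda>x. ?G x ^ n)" by metis
  have "\<exists>C. \<forall>n. (\<Sum>k. norm (a n k)) \<le> C"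
    by (rule composition_imp_bounded_powers[OF a])
       (use uni slice_composition[OF disc comp z'] in auto)
  then obtain C where "\<And>n. (\<Sum>k. norm (a n k)) \<le> C" by blast
  from bounded_powers_imp_coeff_unique[OF p uni a this nz] show ?thesis .
qed

text \<open>The torus is path connected and the modulus is continuous along the path, so it cannot
  jump from 1 to 0.\<close>

lemma norm_constant_on_torus:
  assumes c: "c abs_summable_on A"
    and val: "\<And>z. z \<in> torus \<Longrightarrow> norm (\<Sum>\<^sub>\<infinity>\<alpha>\<in>A. c \<alpha> * monom \<alpha> z) \<in> {0, 1}"
    and z: "z \<in> torus" "z' \<in> torus" and nz: "(\<Sum>\<^sub>\<infinity>\<alpha>\<in>A. c \<alpha> * monom \<alpha> z) \<noteq> 0"
  shows "(\<Sum>\<^sub>\<infinity>\<alpha>\<in>A. c \<alpha> * monom \<alpha> z') \<noteq> 0"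
proof
  assume z0: "(\<Sum>\<^sub>\<infinity>\<alpha>\<in>A. c \<alpha> * monom \<alpha> z') = 0"
  \<comment> \<open>Each coordinate rotates along an arc from \<open>z j\<close> to
    \<open>z' j\<close>.\<close>
  define \<gamma> where "\<gamma> t = (\<lambda>j. z j * cis (t * Arg (z' j / z j)))" for t :: real
  have \<gamma>: "\<gamma> t \<in> torus" for t using z by (simp add: torus_def \<gamma>_def norm_mult)
  have g0: "\<gamma> 0 = z" by (simp add: \<gamma>_def)
  have g1: "\<gamma> 1 = z'"
  proof
    fix j
    have n: "norm (z j) = 1" "norm (z' j) = 1" using z by (auto simp: torus_def)
    hence nz: "z j \<noteq> 0" "z' j \<noteq> 0" by auto
    have "cis (Arg (z' j / z j)) = sgn (z' j / z j)" using nz by (intro cis_Arg) simp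
    also have "\<dots> = z' j / z j" using n by (simp add: sgn_div_norm norm_divide)
    finally show "\<gamma> 1 j = z' j" using nz by (simp add: \<gamma>_def)
  qed
  let ?P = "\<lambda>t. \<Sum>\<^sub>\<infinity>\<alpha>\<in>A. c \<alpha> * monom \<alpha> (\<gamma> t)"
  \<comment> \<open>Finite partial sums depend on finitely many coordinates and are continuous in t;
    the coefficient norms dominate them uniformly.\<close>
  have "uniform_limit {0..1} (\<lambda>X t. \<Sum>\<alpha>\<in>X. c \<alpha> * monom \<alpha> (\<gamma> t)) ?P (finite_subsets_at_top A)"
    by (rule Weierstrass_m_test_general[of _ _ _ "\<lambda>\<alpha>. norm (c \<alpha>)"])
       (use c norm_monom_torus[OF \<gamma>] in \<open>auto simp: norm_mult\<close>)
  hence "continuous_on {0..1} ?P"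
    by (rule uniform_limit_theorem[rotated])
       (auto simp: monom_def \<gamma>_def intro!: continuous_intros always_eventually)
  hence cont: "continuous_on {0..1} (\<lambda>t. norm (?P t))" by (rule continuous_on_norm)
  have "norm (?P 0) = 1" using val[OF z(1)] nz by (simp add: g0)
  moreover have "norm (?P 1) = 0" using z0 by (simp add: g1)
  ultimately obtain t where "norm (?P t) = 1 / 2"
    using IVT2'[of "\<lambda>t. norm (?P t)" 1 "1 / 2" 0] cont by auto
  thus False using val[OF \<gamma>[of t]] by auto
qed

lemma component_is_monomial:
  assumes disc: "\<phi> ` polydisc \<subseteq> polydisc" and comp: "\<forall>f\<in>A_plus. f \<circ> \<phi> \<in> A_plus"
    and torus: "\<phi> ` torus \<subseteq> torus"
  shows "\<exists>\<alpha>\<in>multi_idx. \<exists>e. norm e = 1 \<and> (\<forall>z\<in>polydisc. \<phi> z i = e * monom \<alpha> z)"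
proof -
  have "(\<lambda>z. z i) \<in> A_plus"
  proof -
    have "(\<lambda>_. 1 :: complex) abs_summable_on {(\<lambda>_. 0)(i := 1 :: nat)}" by simp
    from represents_pushforward[OF this, of "\<lambda>\<alpha>. \<alpha>"] show ?thesis
      using single_in_multi_idx by (auto simp: A_plus_def monom_single simp del: One_nat_def)
  qed
  hence "(\<lambda>z. z i) \<circ> \<phi> \<in> A_plus" using comp by blast
  then obtain c where c: "represents c (\<lambda>z. \<phi> z i)" by (auto simp: A_plus_def comp_def)
  have sc: "c abs_summable_on multi_idx" using c by (simp add: represents_def)
  let ?A = "\<lambda>j k. {\<alpha>\<in>multi_idx. \<alpha> j = k}"
  \<comment> \<open>\<open>P j k z\<close> is the coefficient of x^k in the slice through
    \<open>z\<close> in direction \<open>j\<close>.\<close>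
  define P where "P j k z = (\<Sum>\<^sub>\<infinity>\<alpha>\<in>?A j k. c \<alpha> * monom \<alpha> z)" for j :: nat and k z
  have sA: "c abs_summable_on ?A j k" for j k by (rule summable_on_subset_banach[OF sc]) auto
  have P: "abs_power_series (\<lambda>k. P j k z) (\<lambda>x. \<phi> (z(j := x * z j)) i)" if "z \<in> torus" for j z
    unfolding P_def using represents_slice[OF c, of z j] that torus_subset_polydisc by blast
  have uniq: "k = l" if "z \<in> torus" "P j k z \<noteq> 0" "P j l z \<noteq> 0" for j k l z
    using slice_coeff_unique[OF disc comp torus that(1) P[OF that(1)] that(2,3)] .
  \<comment> \<open>With a single nonzero coefficient, evaluating the slice at x = 1 shows that this
    coefficient is the value itself, hence unimodular.\<close>
  have val: "\<phi> z i = P j k z" if z: "z \<in> torus" and nz: "P j k z \<noteq> 0" for j k z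
  proof -
    have "(\<lambda>k. P j k z * 1 ^ k) sums \<phi> (z(j := 1 * z j)) i"
      using P[OF z, of j] unfolding abs_power_series_def by (metis norm_one order_refl)
    hence "(\<lambda>k. P j k z) sums \<phi> z i" by simp
    moreover have "(\<lambda>k. P j k z) sums (\<Sum>l\<in>{k}. P j l z)"
      by (rule sums_finite) (use uniq[OF z nz] in auto)
    ultimately show ?thesis using sums_unique2 by fastforce
  qed
  have norm1: "norm (\<phi> z i) = 1" if "z \<in> torus" for z
    using torus that unfolding torus_def by blast
  have ex: "\<exists>k. P j k z \<noteq> 0" if z: "z \<in> torus" for j z
  proof (rule ccontr)
    assume "\<not> ?thesis"
    hence P0: "\<And>k. P j k z = 0" by blast
    have "(\<lambda>k. P j k z * 1 ^ k) sums \<phi> (z(j := 1 * z j)) i"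
      using P[OF z, of j] unfolding abs_power_series_def by (metis norm_one order_refl)
    hence "\<phi> z i = 0" using P0 sums_unique2[OF sums_zero] by simp
    thus False using norm1[OF z] by simp
  qed
  have one: "(\<lambda>_. 1) \<in> torus" by (simp add: torus_def)
  have "\<exists>d. \<forall>\<alpha>\<in>multi_idx. c \<alpha> \<noteq> 0 \<longrightarrow> \<alpha> j = d" for j
  proof -
    obtain d where d: "P j d (\<lambda>_. 1) \<noteq> 0" using ex[OF one] by blast
    have Pd: "P j d z \<noteq> 0" if "z \<in> torus" for z
      unfolding P_def
    proof (rule norm_constant_on_torus[OF sA _ one that])
      show "norm (\<Sum>\<^sub>\<infinity>\<alpha>\<in>?A j d. c \<alpha> * monom \<alpha> y) \<in> {0, 1}" if "y \<in> torus" for y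
        using val[OF that, of j d] norm1[OF that] unfolding P_def by fastforce
    qed (use d in \<open>simp add: P_def\<close>)
    \<comment> \<open>As \<open>P j d\<close> vanishes nowhere on the torus, every other
      \<open>P j k\<close> vanishes on all of it, and so do the coefficients it contains.\<close>
    have "\<alpha> j = d" if a: "\<alpha> \<in> multi_idx" "c \<alpha> \<noteq> 0" for \<alpha>
    proof (rule ccontr)
      assume ne: "\<alpha> j \<noteq> d"
      have "P j (\<alpha> j) z = 0" if "z \<in> torus" for z
        using uniq[OF that Pd[OF that]] ne by blast
      hence "c \<alpha> = 0" unfolding P_def
        by (intro coeffs_eq_0_if_vanishing_on_torus[OF sA[of j "\<alpha> j"]]) (use a in auto)
      thus False using a by blast
    qed
    thus ?thesis by blast
  qed
  then obtain d where d: "\<And>j \<alpha>. \<alpha> \<in> multi_idx \<Longrightarrow> c \<alpha> \<noteq> 0 \<Longrightarrow> \<alpha> j = d j" by metis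
  have rep: "\<phi> z i = (\<Sum>\<^sub>\<infinity>\<alpha>\<in>multi_idx. c \<alpha> * monom \<alpha> z)" if "z \<in> polydisc" for z
    using c that by (simp add: represents_def)
  have "\<exists>\<alpha>\<in>multi_idx. c \<alpha> \<noteq> 0"
  proof (rule ccontr)
    assume "\<not> ?thesis"
    hence "(\<Sum>\<^sub>\<infinity>\<alpha>\<in>multi_idx. c \<alpha> * monom \<alpha> (\<lambda>_. 1)) = 0" by (intro infsum_0) auto
    hence "\<phi> (\<lambda>_. 1) i = 0" using one torus_subset_polydisc rep[of "\<lambda>_. 1"] by auto
    thus False using norm1[OF one] by simp
  qed
  then obtain \<alpha> where \<alpha>: "\<alpha> \<in> multi_idx" "c \<alpha> \<noteq> 0" by blast
  have only: "c \<beta> = 0" if "\<beta> \<in> multi_idx" "\<beta> \<noteq> \<alpha>" for \<beta>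
  proof (rule ccontr)
    assume "c \<beta> \<noteq> 0"
    hence "\<beta> = \<alpha>" using d[OF that(1)] d[OF \<alpha>] by (metis ext)
    thus False using that by blast
  qed
  have eq: "\<phi> z i = c \<alpha> * monom \<alpha> z" if "z \<in> polydisc" for z
  proof -
    have "\<phi> z i = (\<Sum>\<^sub>\<infinity>\<beta>\<in>{\<alpha>}. c \<beta> * monom \<beta> z)"
      unfolding rep[OF that] by (rule infsum_cong_neutral) (use \<alpha> only in auto)
    thus ?thesis by simp
  qed
  moreover have "norm (c \<alpha>) = 1"
    using norm1[OF one] eq[of "\<lambda>_. 1"] one torus_subset_polydisc norm_monom_torus[OF one, of \<alpha>]
    by (auto simp: norm_mult)
  ultimately show ?thesis using \<alpha> by blast
qed

section \<open>The isometry criterion\<close>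

text \<open>The action of \<open>A_star\<close> on exponents, kept in the natural numbers so that it
  can index monomials.\<close>

definition exponent_pullback :: "(nat \<Rightarrow> nat \<Rightarrow> nat) \<Rightarrow> (nat \<Rightarrow> nat) \<Rightarrow> nat \<Rightarrow> nat" where
  "exponent_pullback a \<alpha> = (\<lambda>j. \<Sum>i\<in>{i. \<alpha> i \<noteq> 0}. a i j * \<alpha> i)"

lemma support_exponent_pullback:
  "{j. exponent_pullback a \<alpha> j \<noteq> 0} \<subseteq> (\<Union>i\<in>{i. \<alpha> i \<noteq> 0}. {j. a i j \<noteq> 0})"
proof
  fix j assume "j \<in> {j. exponent_pullback a \<alpha> j \<noteq> 0}"
  hence "(\<Sum>i\<in>{i. \<alpha> i \<noteq> 0}. a i j * \<alpha> i) \<noteq> 0" by (simp add: exponent_pullback_def)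
  then obtain i where "i \<in> {i. \<alpha> i \<noteq> 0}" "a i j * \<alpha> i \<noteq> 0"
    by (rule sum.not_neutral_contains_not_neutral)
  thus "j \<in> (\<Union>i\<in>{i. \<alpha> i \<noteq> 0}. {j. a i j \<noteq> 0})" by auto
qed

lemma exponent_pullback_in_multi_idx:
  assumes "\<And>i. finite {j. a i j \<noteq> 0}" "\<alpha> \<in> multi_idx"
  shows "exponent_pullback a \<alpha> \<in> multi_idx"
  using finite_subset[OF support_exponent_pullback[of a \<alpha>]] assms by (auto simp: multi_idx_def)

lemma A_star_eq_sum:
  assumes "finite U" "{i. \<alpha> i \<noteq> 0} \<subseteq> U"
  shows "A_star a \<alpha> j = (\<Sum>i\<in>U. int (a i j) * \<alpha> i)"
  unfolding A_star_def by (rule sum.mono_neutral_left) (use assms in auto)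

lemma A_star_of_nat: "A_star a (\<lambda>i. int (\<alpha> i)) = (\<lambda>j. int (exponent_pullback a \<alpha> j))"
  by (simp add: A_star_def exponent_pullback_def)

lemma monom_monomial_map:
  assumes a: "\<And>i. finite {j. a i j \<noteq> 0}" and \<alpha>: "\<alpha> \<in> multi_idx"
    and y: "\<And>i. y i = \<epsilon> i * monom (a i) z"
  shows "monom \<alpha> y = monom \<alpha> \<epsilon> * monom (exponent_pullback a \<alpha>) z"
proof -
  \<comment> \<open>\<open>?T\<close> unites the supports of all rows involved, a common finite
    index set that allows the two products to be exchanged.\<close>
  let ?S = "{i. \<alpha> i \<noteq> 0}" and ?T = "\<Union>i\<in>{i. \<alpha> i \<noteq> 0}. {j. a i j \<noteq> 0}"
  have fin: "finite ?T" using a \<alpha> by (auto simp: multi_idx_def)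
  have "monom \<alpha> y = monom \<alpha> \<epsilon> * (\<Prod>i\<in>?S. monom (a i) z ^ \<alpha> i)"
    by (simp add: monom_def[of \<alpha>] y power_mult_distrib prod.distrib)
  also have "(\<Prod>i\<in>?S. monom (a i) z ^ \<alpha> i) = (\<Prod>i\<in>?S. \<Prod>j\<in>?T. z j ^ (a i j * \<alpha> i))"
  proof (rule prod.cong[OF refl])
    fix i assume "i \<in> ?S"
    hence "monom (a i) z = (\<Prod>j\<in>?T. z j ^ a i j)" by (intro monom_eq_prod[OF fin]) auto
    thus "monom (a i) z ^ \<alpha> i = (\<Prod>j\<in>?T. z j ^ (a i j * \<alpha> i))" by (simp add: prod_power_distrib power_mult)
  qed
  also have "\<dots> = (\<Prod>j\<in>?T. \<Prod>i\<in>?S. z j ^ (a i j * \<alpha> i))" by (rule prod.swap)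
  also have "\<dots> = (\<Prod>j\<in>?T. z j ^ exponent_pullback a \<alpha> j)"
    by (simp add: exponent_pullback_def power_sum)
  also have "\<dots> = monom (exponent_pullback a \<alpha>) z"
    by (rule monom_eq_prod[OF fin support_exponent_pullback, symmetric])
  finally show ?thesis .
qed

lemma represents_cong:
  assumes "represents c f" "\<And>z. z \<in> polydisc \<Longrightarrow> f z = g z"
  shows "represents c g"
  using assms by (simp add: represents_def)

lemma isometry_iff_A_star_injective:
  assumes disc: "\<phi> ` polydisc \<subseteq> polydisc" and a: "\<And>i. finite {j. a i j \<noteq> 0}" and \<epsilon>: "\<And>i. norm (\<epsilon> i) = 1"
    and \<phi>: "\<And>i z. z \<in> polydisc \<Longrightarrow> \<phi> z i = \<epsilon> i * monom (a i) z"
  shows "(\<forall>f\<in>A_plus. A_norm (f \<circ> \<phi>) = A_norm f) \<longleftrightarrow> inj_on (A_star a) int_fin"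
proof
  let ?p = "exponent_pullback a"
  have \<epsilon>t: "\<epsilon> \<in> torus" using \<epsilon> by (simp add: torus_def)
  have m\<phi>: "monom \<alpha> (\<phi> z) = monom \<alpha> \<epsilon> * monom (?p \<alpha>) z" if "\<alpha> \<in> multi_idx" "z \<in> polydisc" for \<alpha> z
    by (rule monom_monomial_map[OF a that(1) \<phi>[OF that(2)]])
  {
    assume inj: "inj_on (A_star a) int_fin"
    have inj_p: "\<alpha> = \<beta>" if "\<alpha> \<in> multi_idx" "\<beta> \<in> multi_idx" "?p \<alpha> = ?p \<beta>" for \<alpha> \<beta>
    proof -
      have "(\<lambda>i. int (\<alpha> i)) = (\<lambda>i. int (\<beta> i))"
        by (rule inj_onD[OF inj]) (use that in \<open>auto simp: A_star_of_nat int_fin_def multi_idx_def\<close>)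
      thus ?thesis by (auto simp: fun_eq_iff)
    qed
    show "\<forall>f\<in>A_plus. A_norm (f \<circ> \<phi>) = A_norm f"
    proof
      fix f assume "f \<in> A_plus"
      then obtain c where c: "represents c f" by (auto simp: A_plus_def)
      \<comment> \<open>The unimodular factor produced by the constants \<open>\<epsilon>\<close> is
        absorbed into the coefficient without changing its modulus.\<close>
      define d where "d \<alpha> = c \<alpha> * monom \<alpha> \<epsilon>" for \<alpha>
      have nd: "norm (d \<alpha>) = norm (c \<alpha>)" for \<alpha> by (simp add: d_def norm_mult norm_monom_torus[OF \<epsilon>t])
      have d: "d abs_summable_on multi_idx" using c by (simp add: nd represents_def)
      have p: "?p ` multi_idx \<subseteq> multi_idx" using exponent_pullback_in_multi_idx[OF a] by auto
      let ?F = "\<lambda>\<beta>. {\<alpha>\<in>multi_idx. ?p \<alpha> = \<beta>}"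
      have "represents (\<lambda>\<beta>. \<Sum>\<^sub>\<infinity>\<alpha>\<in>?F \<beta>. d \<alpha>) (f \<circ> \<phi>)"
      proof (rule represents_cong[OF represents_pushforward[OF d p]])
        fix z assume z: "z \<in> polydisc"
        hence "\<phi> z \<in> polydisc" using disc by blast
        hence "(f \<circ> \<phi>) z = (\<Sum>\<^sub>\<infinity>\<alpha>\<in>multi_idx. c \<alpha> * monom \<alpha> (\<phi> z))" using c by (simp add: represents_def)
        also have "\<dots> = (\<Sum>\<^sub>\<infinity>\<alpha>\<in>multi_idx. d \<alpha> * monom (?p \<alpha>) z)"
          by (rule infsum_cong) (simp add: m\<phi> z d_def)
        finally show "(\<Sum>\<^sub>\<infinity>\<alpha>\<in>multi_idx. d \<alpha> * monom (?p \<alpha>) z) = (f \<circ> \<phi>) z" by simp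
      qed
      hence "A_norm (f \<circ> \<phi>) = (\<Sum>\<^sub>\<infinity>\<beta>\<in>multi_idx. norm (\<Sum>\<^sub>\<infinity>\<alpha>\<in>?F \<beta>. d \<alpha>))" by (rule A_norm_eq)
      also have "\<dots> = (\<Sum>\<^sub>\<infinity>\<beta>\<in>multi_idx. \<Sum>\<^sub>\<infinity>\<alpha>\<in>?F \<beta>. norm (d \<alpha>))"
      proof (rule infsum_cong)
        fix \<beta>
        \<comment> \<open>Injectivity leaves at most one term in each fibre, so the triangle
          inequality loses nothing.\<close>
        have "?F \<beta> = {} \<or> (\<exists>\<alpha>. ?F \<beta> = {\<alpha>})" using inj_p by blast
        thus "norm (\<Sum>\<^sub>\<infinity>\<alpha>\<in>?F \<beta>. d \<alpha>) = (\<Sum>\<^sub>\<infinity>\<alpha>\<in>?F \<beta>. norm (d \<alpha>))"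
        proof (elim disjE exE)
          assume "?F \<beta> = {}"
          thus ?thesis by (simp only: infsum_empty norm_zero)
        next
          fix \<alpha> assume "?F \<beta> = {\<alpha>}"
          thus ?thesis by (simp only:) simp
        qed
      qed
      also have "\<dots> = (\<Sum>\<^sub>\<infinity>\<alpha>\<in>multi_idx. norm (d \<alpha>))"
        by (rule abs_summable_fibers(2)[OF _ p]) (use d in simp)
      also have "\<dots> = A_norm f" by (simp add: nd A_norm_eq[OF c])
      finally show "A_norm (f \<circ> \<phi>) = A_norm f" .
    qed
  next
    assume iso: "\<forall>f\<in>A_plus. A_norm (f \<circ> \<phi>) = A_norm f"
    show "inj_on (A_star a) int_fin"
    proof (rule inj_onI, rule ccontr)
      fix \<alpha> \<beta> assume ab: "\<alpha> \<in> int_fin" "\<beta> \<in> int_fin" "A_star a \<alpha> = A_star a \<beta>" "\<alpha> \<noteq> \<beta>"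
      \<comment> \<open>\<open>p\<close> and \<open>q\<close> are the positive and negative parts of
        \<alpha> - \<beta>; their difference is a kernel element, so they have the same
        image.\<close>
      define p where "p i = nat (\<alpha> i - \<beta> i)" for i
      define q where "q i = nat (\<beta> i - \<alpha> i)" for i
      let ?U = "{i. \<alpha> i \<noteq> 0} \<union> {i. \<beta> i \<noteq> 0}"
      have U: "finite ?U" using ab by (simp add: int_fin_def)
      have sp: "{i. p i \<noteq> 0} \<subseteq> ?U" "{i. q i \<noteq> 0} \<subseteq> ?U" by (auto simp: p_def q_def)
      have pq: "p \<in> multi_idx" "q \<in> multi_idx" using finite_subset[OF _ U] sp by (auto simp: multi_idx_def)
      have "p \<noteq> q"
      proof
        assume "p = q"
        hence "\<alpha> i = \<beta> i" for i by (auto simp: p_def q_def fun_eq_iff dest!: spec[of _ i])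
        thus False using ab by auto
      qed
      have peq: "?p p = ?p q"
      proof
        fix j
        have "int (?p p j) - int (?p q j) = (\<Sum>i\<in>?U. int (a i j) * int (p i)) - (\<Sum>i\<in>?U. int (a i j) * int (q i))"
          using A_star_eq_sum[OF U, of "\<lambda>i. int (p i)" a j] A_star_eq_sum[OF U, of "\<lambda>i. int (q i)" a j] sp
          by (simp add: A_star_of_nat)
        also have "\<dots> = (\<Sum>i\<in>?U. int (a i j) * \<alpha> i) - (\<Sum>i\<in>?U. int (a i j) * \<beta> i)"
          unfolding sum_subtractf[symmetric] right_diff_distrib[symmetric]
          by (intro sum.cong refl) (auto simp: p_def q_def)
        also have "\<dots> = A_star a \<alpha> j - A_star a \<beta> j"
          using A_star_eq_sum[OF U, of \<alpha> a j] A_star_eq_sum[OF U, of \<beta> a j] by auto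
        finally show "?p p j = ?p q j" using ab(3) by simp
      qed
      \<comment> \<open>The conjugates cancel the phases acquired under \<phi>, so both terms become
        the same monomial with opposite signs: the composition vanishes while the norm of
        \<open>f\<close> is 2.\<close>
      define c where "c \<gamma> = (if \<gamma> = p then cnj (monom p \<epsilon>) else if \<gamma> = q then - cnj (monom q \<epsilon>) else 0)" for \<gamma>
      have c0: "c \<gamma> = 0" if "\<gamma> \<notin> {p, q}" for \<gamma> using that by (simp add: c_def)
      have sc: "c abs_summable_on multi_idx"
        by (rule finite_nonzero_values_imp_summable_on, rule finite_subset[of _ "{p, q}"]) (use c0 in auto)
      define f where "f z = (\<Sum>\<^sub>\<infinity>\<gamma>\<in>multi_idx. c \<gamma> * monom \<gamma> z)" for z
      have rf: "represents c f" using sc by (simp add: represents_def f_def)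
      have fz: "f z = c p * monom p z + c q * monom q z" for z
      proof -
        have "f z = (\<Sum>\<^sub>\<infinity>\<gamma>\<in>{p, q}. c \<gamma> * monom \<gamma> z)"
          unfolding f_def by (rule infsum_cong_neutral) (use pq c0 in auto)
        thus ?thesis using \<open>p \<noteq> q\<close> by simp
      qed
      have unit: "cnj (monom \<gamma> \<epsilon>) * monom \<gamma> \<epsilon> = 1" for \<gamma>
        using norm_monom_torus[OF \<epsilon>t, of \<gamma>] complex_norm_square[of "monom \<gamma> \<epsilon>"] by (simp add: mult.commute)
      have "(f \<circ> \<phi>) z = 0" if "z \<in> polydisc" for z
      proof -
        have "(f \<circ> \<phi>) z = (cnj (monom p \<epsilon>) * monom p \<epsilon>) * monom (?p p) z - (cnj (monom q \<epsilon>) * monom q \<epsilon>) * monom (?p q) z"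
          using \<open>p \<noteq> q\<close> by (simp add: fz m\<phi> pq that c_def mult.assoc)
        thus ?thesis by (simp add: unit peq)
      qed
      hence "represents (\<lambda>_. 0) (f \<circ> \<phi>)" by (simp add: represents_def)
      hence "A_norm (f \<circ> \<phi>) = 0" by (simp add: A_norm_eq)
      moreover have "A_norm f = 2"
      proof -
        have "A_norm f = (\<Sum>\<^sub>\<infinity>\<gamma>\<in>{p, q}. norm (c \<gamma>))"
          unfolding A_norm_eq[OF rf] by (rule infsum_cong_neutral) (use pq c0 in auto)
        thus ?thesis using \<open>p \<noteq> q\<close> by (simp add: c_def norm_monom_torus[OF \<epsilon>t])
      qed
      moreover have "f \<in> A_plus" using rf by (auto simp: A_plus_def)
      ultimately show False using iso by fastforce
    qed
  }
qed

theorem theorem20: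
  fixes \<phi> :: "(nat \<Rightarrow> complex) \<Rightarrow> (nat \<Rightarrow> complex)"
  assumes maps_disc: "\<phi> ` polydisc \<subseteq> polydisc"
    and comp_bounded: "\<forall>f\<in>A_plus. f \<circ> \<phi> \<in> A_plus"
    and maps_torus: "\<phi> ` torus \<subseteq> torus"
  shows "(\<exists>a :: nat \<Rightarrow> nat \<Rightarrow> nat. \<exists>\<epsilon> :: nat \<Rightarrow> complex.
            (\<forall>i. finite {j. a i j \<noteq> 0}) \<and> (\<forall>i. norm (\<epsilon> i) = 1) \<and>
            (\<forall>i. \<forall>z\<in>polydisc. \<phi> z i = \<epsilon> i * monom (a i) z))
       \<and> (\<forall>(a :: nat \<Rightarrow> nat \<Rightarrow> nat) (\<epsilon> :: nat \<Rightarrow> complex).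
            (\<forall>i. finite {j. a i j \<noteq> 0}) \<and> (\<forall>i. norm (\<epsilon> i) = 1) \<and>
            (\<forall>i. \<forall>z\<in>polydisc. \<phi> z i = \<epsilon> i * monom (a i) z) \<longrightarrow>
            ((\<forall>f\<in>A_plus. A_norm (f \<circ> \<phi>) = A_norm f) \<longleftrightarrow> inj_on (A_star a) int_fin))"
proof (intro conjI allI impI)
  have "\<forall>i. \<exists>\<alpha> e. \<alpha> \<in> multi_idx \<and> norm e = 1 \<and> (\<forall>z\<in>polydisc. \<phi> z i = e * monom \<alpha> z)"
    using component_is_monomial[OF maps_disc comp_bounded maps_torus] by blast
  then obtain a \<epsilon> where "\<And>i. a i \<in> multi_idx \<and> norm (\<epsilon> i) = 1 \<and> (\<forall>z\<in>polydisc. \<phi> z i = \<epsilon> i * monom (a i) z)"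
    by metis
  thus "\<exists>a \<epsilon>. (\<forall>i. finite {j. a i j \<noteq> 0}) \<and> (\<forall>i. norm (\<epsilon> i) = 1) \<and>
            (\<forall>i. \<forall>z\<in>polydisc. \<phi> z i = \<epsilon> i * monom (a i) z)"
    by (intro exI[of _ a] exI[of _ \<epsilon>]) (auto simp: multi_idx_def)
next
  fix a :: "nat \<Rightarrow> nat \<Rightarrow> nat" and \<epsilon> :: "nat \<Rightarrow> complex"
  assume "(\<forall>i. finite {j. a i j \<noteq> 0}) \<and> (\<forall>i. norm (\<epsilon> i) = 1) \<and>
            (\<forall>i. \<forall>z\<in>polydisc. \<phi> z i = \<epsilon> i * monom (a i) z)"
  thus "(\<forall>f\<in>A_plus. A_norm (f \<circ> \<phi>) = A_norm f) \<longleftrightarrow> inj_on (A_star a) int_fin"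
    by (intro isometry_iff_A_star_injective[OF maps_disc, of a \<epsilon>]) blast+
qed

end
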